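(* Let $(\mathfrak{A},\Phi)$ be a $C^*$-dynamical system, and fix $\lambda\in\mathbb{T}\smallsetminus\sigma^{(\mathrm{ph},\mathrm{f})}_{\mathrm{pp}}(\Phi)$. Then for each $a\in\mathfrak{A}$, $$\lim_{n\to+\infty}\frac1{n}\sum_{k=0}^{n-1}\lambda^{-k}\Phi^k(a)=0$$ in the norm topology of $\mathfrak{A}$.
   Context: $\mathbb{T}=\{\lambda\in\mathbb{C}\mid|\lambda|=1\}$. A $C^*$-dynamical system $(\mathfrak{A},\Phi)$ means a unital $C^*$-algebra $\mathfrak{A}\neq\{0\}$ together with a unital (identity-preserving) $*$-homomorphism $\Phi:\mathfrak{A}\to\mathfrak{A}$. $\mathcal{S}(\mathfrak{A})^\Phi$ is the set of states $\varphi$ of $\mathfrak{A}$ with $\varphi\circ\Phi=\varphi$. For $\varphi\in\mathcal{S}(\mathfrak{A})^\Phi$ with GNS representation $(\mathcal{H}_\varphi,\pi_\varphi,\xi_\varphi)$, $V_{\varphi,\Phi}$ denotes the unique isometry on $\mathcal{H}_\varphi$ with $V_{\varphi,\Phi}\pi_\varphi(a)\xi_\varphi=\pi_\varphi(\Phi(a))\xi_\varphi$ for all $a\in\mathfrak{A}$. Put $\sigma^{\mathrm{ph}}_{\mathrm{pp}}(V_{\varphi,\Phi}):=\{\lambda\in\mathbb{T}\mid\lambda\text{ is an eigenvalue of }V_{\varphi,\Phi}\}$. The full peripheral pure-point spectrum of $\Phi$ is $\sigma^{(\mathrm{ph},\mathrm{f})}_{\mathrm{pp}}(\Phi):=\bigcup\{\sigma^{\mathrm{ph}}_{\mathrm{pp}}(V_{\varphi,\Phi})\mid\varphi\in\mathcal{S}(\mathfrak{A})^\Phi\}$.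 *)

theory Defs
  imports "HOL-Analysis.Analysis"
begin

(* A unital C*-algebra different from {0}: the carrier is the whole type.  In a nonzero unital
   C*-algebra norm 1 = 1 and 0 ~= 1 hold automatically, so real_normed_algebra_1 adds nothing. *)
class cstar_algebra = banach + real_normed_algebra_1 +
  fixes scaleC :: "complex \<Rightarrow> 'a \<Rightarrow> 'a"  (infixr "*\<^sub>C" 75)
    and star :: "'a \<Rightarrow> 'a"
  assumes scaleR_scaleC: "r *\<^sub>R x = complex_of_real r *\<^sub>C x"
    and scaleC_add_right: "c *\<^sub>C (x + y) = c *\<^sub>C x + c *\<^sub>C y"
    and scaleC_add_left: "(c + d) *\<^sub>C x = c *\<^sub>C x + d *\<^sub>C x"
    and scaleC_scaleC: "c *\<^sub>C (d *\<^sub>C x) = (c * d) *\<^sub>C x"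
    and scaleC_one: "1 *\<^sub>C x = x"
    and mult_scaleC_left: "(c *\<^sub>C x) * y = c *\<^sub>C (x * y)"
    and mult_scaleC_right: "x * (c *\<^sub>C y) = c *\<^sub>C (x * y)"
    and norm_scaleC: "norm (c *\<^sub>C x) = cmod c * norm x"
    and star_star: "star (star x) = x"
    and star_add: "star (x + y) = star x + star y"
    and star_scaleC: "star (c *\<^sub>C x) = cnj c *\<^sub>C star x"
    and star_mult: "star (x * y) = star y * star x"
    and cstar_identity: "norm (star x * x) = (norm x)\<^sup>2"

definition unital_star_hom :: "('a::cstar_algebra \<Rightarrow> 'b::cstar_algebra) \<Rightarrow> bool" where
  "unital_star_hom \<Phi> \<longleftrightarrow>
     (\<forall>x y. \<Phi> (x + y) = \<Phi> x + \<Phi> y) \<and>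
     (\<forall>c x. \<Phi> (c *\<^sub>C x) = c *\<^sub>C \<Phi> x) \<and>
     (\<forall>x y. \<Phi> (x * y) = \<Phi> x * \<Phi> y) \<and>
     (\<forall>x. \<Phi> (star x) = star (\<Phi> x)) \<and>
     \<Phi> 1 = 1"

definition states :: "('a::cstar_algebra \<Rightarrow> complex) set" where
  "states = {\<phi>.
     (\<forall>x y. \<phi> (x + y) = \<phi> x + \<phi> y) \<and>
     (\<forall>c x. \<phi> (c *\<^sub>C x) = c * \<phi> x) \<and>
     (\<forall>x. \<phi> (star x * x) \<in> \<real>\<^sub>\<ge>\<^sub>0) \<and>
     \<phi> 1 = 1}"

definition invariant_states :: "('a::cstar_algebra \<Rightarrow> 'a) \<Rightarrow> ('a \<Rightarrow> complex) set" where
  "invariant_states \<Phi> = {\<phi> \<in> states. \<phi> \<circ> \<Phi> = \<phi>}"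

(* The GNS Hilbert space of phi is the completion of A / {a. phi (a* a) = 0}, realised as
   Cauchy sequences of A for the GNS seminorm modulo null sequences.  All GNS representations
   of phi are unitarily equivalent, so this choice does not affect eigenvalues.  The structure
   maps on classes below are given by unions over representatives (as for HOL quotients with
   congruences): for a state phi all the classes in such a union coincide. *)

definition gns_seminorm :: "('a::cstar_algebra \<Rightarrow> complex) \<Rightarrow> 'a \<Rightarrow> real" where
  "gns_seminorm \<phi> a = sqrt (Re (\<phi> (star a * a)))"

definition gns_Cauchy :: "('a::cstar_algebra \<Rightarrow> complex) \<Rightarrow> (nat \<Rightarrow> 'a) set" where
  "gns_Cauchy \<phi> = {X. \<forall>e>0. \<exists>N. \<forall>m\<ge>N. \<forall>n\<ge>N. gns_seminorm \<phi> (X m - X n) < e}"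

definition gns_rel :: "('a::cstar_algebra \<Rightarrow> complex) \<Rightarrow> ((nat \<Rightarrow> 'a) \<times> (nat \<Rightarrow> 'a)) set" where
  "gns_rel \<phi> = {(X, Y). X \<in> gns_Cauchy \<phi> \<and> Y \<in> gns_Cauchy \<phi> \<and>
     (\<lambda>n. gns_seminorm \<phi> (X n - Y n)) \<longlonglongrightarrow> 0}"

definition gns_class :: "('a::cstar_algebra \<Rightarrow> complex) \<Rightarrow> (nat \<Rightarrow> 'a) \<Rightarrow> (nat \<Rightarrow> 'a) set" where
  "gns_class \<phi> X = gns_rel \<phi> `` {X}"

definition gns_space :: "('a::cstar_algebra \<Rightarrow> complex) \<Rightarrow> (nat \<Rightarrow> 'a) set set" where
  "gns_space \<phi> = gns_Cauchy \<phi> // gns_rel \<phi>"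

definition gns_zero :: "('a::cstar_algebra \<Rightarrow> complex) \<Rightarrow> (nat \<Rightarrow> 'a) set" where
  "gns_zero \<phi> = gns_class \<phi> (\<lambda>n. 0)"

definition gns_add ::
  "('a::cstar_algebra \<Rightarrow> complex) \<Rightarrow> (nat \<Rightarrow> 'a) set \<Rightarrow> (nat \<Rightarrow> 'a) set \<Rightarrow> (nat \<Rightarrow> 'a) set" where
  "gns_add \<phi> P Q = (\<Union>X\<in>P. \<Union>Y\<in>Q. gns_class \<phi> (\<lambda>n. X n + Y n))"

definition gns_scale ::
  "('a::cstar_algebra \<Rightarrow> complex) \<Rightarrow> complex \<Rightarrow> (nat \<Rightarrow> 'a) set \<Rightarrow> (nat \<Rightarrow> 'a) set" where
  "gns_scale \<phi> c P = (\<Union>X\<in>P. gns_class \<phi> (\<lambda>n. c *\<^sub>C X n))"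

(* conjugate-linear in the first argument *)
definition gns_inner ::
  "('a::cstar_algebra \<Rightarrow> complex) \<Rightarrow> (nat \<Rightarrow> 'a) set \<Rightarrow> (nat \<Rightarrow> 'a) set \<Rightarrow> complex" where
  "gns_inner \<phi> P Q = (THE c. \<forall>X\<in>P. \<forall>Y\<in>Q. (\<lambda>n. \<phi> (star (X n) * Y n)) \<longlonglongrightarrow> c)"

definition gns_norm :: "('a::cstar_algebra \<Rightarrow> complex) \<Rightarrow> (nat \<Rightarrow> 'a) set \<Rightarrow> real" where
  "gns_norm \<phi> P = sqrt (Re (gns_inner \<phi> P P))"

definition gns_rep ::
  "('a::cstar_algebra \<Rightarrow> complex) \<Rightarrow> 'a \<Rightarrow> (nat \<Rightarrow> 'a) set \<Rightarrow> (nat \<Rightarrow> 'a) set" where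
  "gns_rep \<phi> a P = (\<Union>X\<in>P. gns_class \<phi> (\<lambda>n. a * X n))"

definition gns_vector :: "('a::cstar_algebra \<Rightarrow> complex) \<Rightarrow> (nat \<Rightarrow> 'a) set" where
  "gns_vector \<phi> = gns_class \<phi> (\<lambda>n. 1)"

definition gns_linear_isometry ::
  "('a::cstar_algebra \<Rightarrow> complex) \<Rightarrow> ((nat \<Rightarrow> 'a) set \<Rightarrow> (nat \<Rightarrow> 'a) set) \<Rightarrow> bool" where
  "gns_linear_isometry \<phi> V \<longleftrightarrow>
     V \<in> gns_space \<phi> \<rightarrow> gns_space \<phi> \<and>
     (\<forall>P\<in>gns_space \<phi>. \<forall>Q\<in>gns_space \<phi>. V (gns_add \<phi> P Q) = gns_add \<phi> (V P) (V Q)) \<and>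
     (\<forall>c. \<forall>P\<in>gns_space \<phi>. V (gns_scale \<phi> c P) = gns_scale \<phi> c (V P)) \<and>
     (\<forall>P\<in>gns_space \<phi>. gns_norm \<phi> (V P) = gns_norm \<phi> P)"

(* extensional only fixes the values outside the Hilbert space, which makes V unique as a
   HOL function *)
definition gns_isometry ::
  "('a::cstar_algebra \<Rightarrow> complex) \<Rightarrow> ('a \<Rightarrow> 'a) \<Rightarrow> (nat \<Rightarrow> 'a) set \<Rightarrow> (nat \<Rightarrow> 'a) set" where
  "gns_isometry \<phi> \<Phi> = (THE V. V \<in> extensional (gns_space \<phi>) \<and> gns_linear_isometry \<phi> V \<and>
     (\<forall>a. V (gns_rep \<phi> a (gns_vector \<phi>)) = gns_rep \<phi> (\<Phi> a) (gns_vector \<phi>)))"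

definition gns_eigenvalue ::
  "('a::cstar_algebra \<Rightarrow> complex) \<Rightarrow> ((nat \<Rightarrow> 'a) set \<Rightarrow> (nat \<Rightarrow> 'a) set) \<Rightarrow> complex \<Rightarrow> bool" where
  "gns_eigenvalue \<phi> V z \<longleftrightarrow>
     (\<exists>P\<in>gns_space \<phi>. P \<noteq> gns_zero \<phi> \<and> V P = gns_scale \<phi> z P)"

definition peripheral_pp_spectrum ::
  "('a::cstar_algebra \<Rightarrow> complex) \<Rightarrow> ('a \<Rightarrow> 'a) \<Rightarrow> complex set" where
  "peripheral_pp_spectrum \<phi> \<Phi> = {z \<in> sphere 0 1. gns_eigenvalue \<phi> (gns_isometry \<phi> \<Phi>) z}"

definition full_peripheral_pp_spectrum :: "('a::cstar_algebra \<Rightarrow> 'a) \<Rightarrow> complex set" where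
  "full_peripheral_pp_spectrum \<Phi> = (\<Union>\<phi>\<in>invariant_states \<Phi>. peripheral_pp_spectrum \<phi> \<Phi>)"

end

theory Submission imports Defs begin

text \<open>
  Write $w = z^{-1}$ and let $M_n(a)$ be the mean of the first $n$ vectors $w^k \Phi^k(a)$. The
  theorem is proved in contrapositive form: if $M_n(a)$ does not tend to $0$ in norm, then $z$ is
  an eigenvalue of the isometry attached to some invariant state.

  So let $\varepsilon > 0$ with $\|M_n(a)\| \ge \varepsilon$ for infinitely many $n$. The crucial point
  is to find a single invariant state $\varphi$ with $\varphi(M_m(a)^* M_m(a)) \ge \varepsilon^2$ for all
  $m \ge 1$ (\<open>invariant_state_exists\<close>). Two facts make its requirements consistent. First, averaging
  commutes asymptotically with itself: for fixed $m$ the $N$-th mean of $M_m(a)$ differs from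
  $M_N(a)$ by a term that vanishes in norm as $N$ grows (\<open>cesaro_cesaro_tendsto\<close>). Secondly, the
  square of a mean is at most the mean of the squares (\<open>positive_cesaro_variance\<close>). Hence the
  ordinary $N$-th mean along $\Phi$ of $M_m(a)^* M_m(a)$ dominates $M_N(a)^* M_N(a)$ up to a vanishing
  error, and the latter has norm at least $\varepsilon^2$ infinitely often. Instead of
  extracting a limit point of states, all requirements on $\varphi$ are put into one convex cone that
  does not contain $-1$; a Hahn-Banach argument (\<open>positive_functional_extension\<close>) then gives the
  state.

  In the GNS space of $\varphi$ the operator $w V$ is an isometry, so by von Neumann's mean ergodic
  theorem the vectors $M_n(a)\xi$ converge to a vector fixed by $w V$, that is, to an eigenvector of
  $V$ for $z$ unless the limit is $0$; and the lower bound on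
  $\varphi(M_m(a)^* M_m(a)) = \|M_m(a)\xi\|^2$ excludes $0$ (\<open>mean_ergodic_gns_Cauchy\<close>,
  \<open>eigenvalue_from_invariant_state\<close>). The means themselves form a Cauchy sequence of the GNS
  seminorm, so their class is the eigenvector.

  All of this rests on the order structure of a $C^*$-algebra, above all on the positivity of
  $x^* x$ (\<open>positive_star_mult_self\<close>). It is derived from the norm axioms by means of square roots,
  without spectral theory or functional calculus.
\<close>

section \<open>Algebra of the involution\<close>

lemma scaleC_zero_left [simp]: "0 *\<^sub>C (x::'a::cstar_algebra) = 0"
  using scaleR_scaleC[of 0 x] by simp

lemma scaleC_zero_right [simp]: "c *\<^sub>C (0::'a::cstar_algebra) = 0"
  using scaleC_add_right[of c 0 "0::'a"] by simp

lemma scaleC_minus_right [simp]: "c *\<^sub>C (- x::'a::cstar_algebra) = - (c *\<^sub>C x)"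
  using scaleC_add_right[of c x "- x"] by (simp add: eq_neg_iff_add_eq_0 add.commute)

lemma scaleC_minus_left [simp]: "(- c) *\<^sub>C (x::'a::cstar_algebra) = - (c *\<^sub>C x)"
  using scaleC_add_left[of c "- c" x] by (simp add: eq_neg_iff_add_eq_0 add.commute)

lemma scaleC_diff_right: "c *\<^sub>C (x - y::'a::cstar_algebra) = c *\<^sub>C x - c *\<^sub>C y"
  using scaleC_add_right[of c x "- y"] by simp

lemma star_zero [simp]: "star (0::'a::cstar_algebra) = 0"
  using star_add[of 0 "0::'a"] by simp

lemma star_minus [simp]: "star (- x::'a::cstar_algebra) = - star x"
  using star_add[of x "- x"] by (simp add: eq_neg_iff_add_eq_0 add.commute)

lemma star_diff: "star (x - y::'a::cstar_algebra) = star x - star y"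
  using star_add[of x "- y"] by simp

lemma star_scaleR: "star (r *\<^sub>R x::'a::cstar_algebra) = r *\<^sub>R star x"
  by (simp add: scaleR_scaleC star_scaleC)

lemma star_one [simp]: "star (1::'a::cstar_algebra) = 1"
  using star_mult[of "star 1" "1::'a"] by (simp add: star_star)

lemma star_of_real [simp]: "star (of_real r::'a::cstar_algebra) = of_real r"
  by (simp add: of_real_def star_scaleR)

lemma star_sum: "star (\<Sum>k\<in>A. f k::'a::cstar_algebra) = (\<Sum>k\<in>A. star (f k))"
  by (induction A rule: infinite_finite_induct) (auto simp: star_add)

lemma norm_star [simp]: "norm (star x::'a::cstar_algebra) = norm x"
proof -
  have le: "norm y \<le> norm (star y)" for y :: 'a
  proof (cases "y = 0")
    case False
    have "norm y * norm y \<le> norm (star y) * norm y"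
      using norm_mult_ineq[of "star y" y] by (simp add: cstar_identity power2_eq_square)
    then show ?thesis using False by simp
  qed auto
  show ?thesis using le[of x] le[of "star x"] by (simp add: star_star)
qed

lemma tendsto_star: "(X \<longlongrightarrow> x) F \<Longrightarrow> ((\<lambda>n. star (X n::'a::cstar_algebra)) \<longlongrightarrow> star x) F"
  unfolding tendsto_iff dist_norm by (simp flip: star_diff)

section \<open>Positive elements of a $C^*$-algebra\<close>

text \<open>
  The spectrum of a self-adjoint $h$ lies in $[0, 2t]$ exactly when $\|t - h\| \le t$, so this is the
  usual notion of positivity, expressed by the norm alone. In this form the convex cone axioms follow
  from the triangle inequality.
\<close>

definition positive :: "'a::cstar_algebra \<Rightarrow> bool" where
  "positive h \<longleftrightarrow> star h = h \<and> (\<exists>t. norm (of_real t - h) \<le> t)"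

lemma positive_star: "positive h \<Longrightarrow> star h = h"
  by (simp add: positive_def)

lemma positive_add: "positive h \<Longrightarrow> positive k \<Longrightarrow> positive (h + k)"
proof -
  assume "positive h" "positive k"
  then obtain t s where "star h = h" "star k = k" "norm (of_real t - h) \<le> t" "norm (of_real s - k) \<le> s"
    unfolding positive_def by blast
  moreover have "norm (of_real (t + s) - (h + k)) \<le> norm (of_real t - h) + norm (of_real s - k)"
    by (metis add_diff_add norm_triangle_ineq of_real_add)
  ultimately show ?thesis unfolding positive_def by (intro conjI exI[of _ "t + s"]) (auto simp: star_add)
qed

lemma positive_scaleR: "positive h \<Longrightarrow> 0 \<le> c \<Longrightarrow> positive (c *\<^sub>R h)"
proof -
  assume "positive h" and c: "0 \<le> c"
  then obtain t where "star h = h" "norm (of_real t - h) \<le> t"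
    unfolding positive_def by blast
  moreover have "norm (of_real (c * t) - c *\<^sub>R h) = c * norm (of_real t - h)"
    using c by (simp add: of_real_def flip: scaleR_scaleR scaleR_diff_right)
  ultimately show ?thesis unfolding positive_def using c
    by (intro conjI exI[of _ "c * t"]) (auto simp: star_scaleR mult_left_mono)
qed

lemma positive_zero [simp]: "positive 0"
  unfolding positive_def by (auto intro: exI[of _ 0])

lemma positive_sum: "(\<And>k. k \<in> A \<Longrightarrow> positive (f k)) \<Longrightarrow> positive (\<Sum>k\<in>A. f k)"
  by (induction A rule: infinite_finite_induct) (auto intro: positive_add)

lemma positive_of_real_add: "star h = h \<Longrightarrow> norm h \<le> t \<Longrightarrow> positive (of_real t + h)"
  unfolding positive_def by (intro conjI exI[of _ t]) (auto simp: star_add)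

lemma positive_of_real_diff: "star h = h \<Longrightarrow> norm h \<le> t \<Longrightarrow> positive (of_real t - h)"
  using positive_of_real_add[of "- h" t] by simp

lemma positive_of_real_iff [simp]: "positive (of_real t :: 'a::cstar_algebra) \<longleftrightarrow> 0 \<le> t"
proof
  assume "positive (of_real t :: 'a)"
  then obtain s where "norm (of_real (s - t) :: 'a) \<le> s" unfolding positive_def by auto
  then show "0 \<le> t" unfolding norm_of_real by linarith
next
  assume "0 \<le> t" then show "positive (of_real t :: 'a)"
    using positive_of_real_add[of 0 t] by simp
qed

text \<open>
  With $w = 1 - h$, the element $s = 1 - y$ is a square root of $h$ as soon as $2 y = w + y^2$. This
  fixed point is reached by iteration from $0$. The iterates are polynomials in $w$ with nonnegative
  coefficients, so they and their increments are dominated by the same iteration for the number $1$ in place of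
  $w$, which increases to a limit. This covers the boundary case $\|w\| = 1$, where
  the iteration is no contraction. Being a limit of real polynomials in $w$, the element $s$ is
  self-adjoint and commutes with everything that commutes with $h$.
\<close>

lemma square_root_near_one:
  fixes h :: "'a::cstar_algebra"
  assumes sa: "star h = h" and le: "norm (1 - h) \<le> 1"
  obtains s where "star s = s" "norm (1 - s) \<le> 1" "s * s = h" "\<And>y. y * h = h * y \<Longrightarrow> y * s = s * y"
proof -
  define w where "w = 1 - h"
  define Y where "Y = rec_nat (0::'a) (\<lambda>_ y. (1/2) *\<^sub>R (w + y * y))"
  define T where "T = rec_nat (0::real) (\<lambda>_ t. (1 + t * t) / 2)"
  have Y0: "Y 0 = 0" and YS: "Y (Suc n) = (1/2) *\<^sub>R (w + Y n * Y n)" for n by (simp_all add: Y_def)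
  have T0: "T 0 = 0" and TS: "T (Suc n) = (1 + T n * T n) / 2" for n by (simp_all add: T_def)
  have wn: "norm w \<le> 1" using le by (simp add: w_def)
  have Tb: "0 \<le> T n \<and> T n \<le> 1" for n
    by (induction n) (auto simp: T0 TS mult_le_one)
  have Tinc: "T n \<le> T (Suc n)" for n
    using zero_le_power2[of "T n - 1"] unfolding TS power2_eq_square by (simp add: field_simps)
  have Yn: "norm (Y n) \<le> T n" for n
  proof (induction n)
    case (Suc n)
    have "norm (w + Y n * Y n) \<le> 1 + T n * T n"
      using Suc Tb[of n] wn norm_triangle_ineq[of w "Y n * Y n"] norm_mult_ineq[of "Y n" "Y n"]
        mult_mono[OF Suc Suc] by auto
    then show ?case by (simp add: YS TS)
  qed (simp add: Y0 T0)
  have Ycomm: "y * Y n = Y n * y" if "y * h = h * y" for y n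
  proof (induction n)
    case (Suc n)
    have "y * (Y n * Y n) = Y n * Y n * y" using Suc by (metis mult.assoc)
    then show ?case using that by (simp add: YS w_def algebra_simps)
  qed (simp add: Y0)
  have hY: "h * Y n = Y n * h" for n using Ycomm[of h n] by simp
  have YY: "Y m * Y n = Y n * Y m" for m n using Ycomm[of "Y m" n] hY by simp
  have Ysa: "star (Y n) = Y n" for n
    by (induction n) (auto simp: Y0 YS star_scaleR star_add star_mult w_def star_diff sa)
  have step: "norm (Y (Suc n) - Y n) \<le> T (Suc n) - T n" for n
  proof (induction n)
    case 0 show ?case using wn by (simp add: Y0 T0 YS TS)
  next
    case (Suc n)
    have "Y (Suc (Suc n)) - Y (Suc n)
        = (1/2) *\<^sub>R (w + Y (Suc n) * Y (Suc n)) - (1/2) *\<^sub>R (w + Y n * Y n)"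
      by (simp only: YS)
    also have "\<dots> = (1/2) *\<^sub>R (Y (Suc n) * Y (Suc n) - Y n * Y n)"
      by (simp add: scaleR_add_right scaleR_diff_right)
    also have "Y (Suc n) * Y (Suc n) - Y n * Y n = (Y (Suc n) + Y n) * (Y (Suc n) - Y n)"
      using YY[of n "Suc n"] by (simp add: algebra_simps)
    finally have "norm (Y (Suc (Suc n)) - Y (Suc n)) = (1/2) * norm ((Y (Suc n) + Y n) * (Y (Suc n) - Y n))"
      by simp
    also have "norm ((Y (Suc n) + Y n) * (Y (Suc n) - Y n)) \<le> (T (Suc n) + T n) * (T (Suc n) - T n)"
      using Yn[of n] Yn[of "Suc n"] Suc norm_triangle_ineq[of "Y (Suc n)" "Y n"] Tb[of n] Tb[of "Suc n"]
      by (intro order_trans[OF norm_mult_ineq] mult_mono) auto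
    also have "(1/2) * ((T (Suc n) + T n) * (T (Suc n) - T n))
        = (1 + T (Suc n) * T (Suc n)) / 2 - (1 + T n * T n) / 2"
      by (simp add: field_simps)
    also have "\<dots> = T (Suc (Suc n)) - T (Suc n)" by (simp only: TS)
    finally show ?case by simp
  qed
  have "convergent T"
    using Tb Tinc by (intro Bseq_monoseq_convergent BseqI'[of _ 1]) (auto simp: monoseq_Suc)
  then obtain l where "T \<longlonglongrightarrow> l" by (auto simp: convergent_def)
  then have "summable (\<lambda>n. T (Suc n) - T n)" using telescope_sums sums_summable by blast
  then have "summable (\<lambda>n. Y (Suc n) - Y n)" by (rule summable_comparison_test'[of _ 0]) (use step in auto)
  then obtain y where "(\<lambda>n. \<Sum>k<n. Y (Suc k) - Y k) \<longlonglongrightarrow> y"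
    by (auto dest: summable_LIMSEQ)
  then have y: "Y \<longlonglongrightarrow> y" by (simp add: sum_lessThan_telescope Y0)
  have yfix: "y = (1/2) *\<^sub>R (w + y * y)"
  proof -
    have "(\<lambda>n. Y (Suc n)) \<longlonglongrightarrow> (1/2) *\<^sub>R (w + y * y)"
      unfolding YS by (intro tendsto_intros y)
    then show ?thesis using LIMSEQ_Suc[OF y] LIMSEQ_unique by blast
  qed
  have "2 *\<^sub>R y = w + y * y" by (subst yfix) simp
  then have root: "(1 - y) * (1 - y) = h" by (simp add: w_def algebra_simps scaleR_2)
  have ny: "norm y \<le> 1" using Yn Tb by (intro LIMSEQ_le_const2[OF tendsto_norm[OF y]]) (meson order_trans)
  have sy: "star y = y"
    using tendsto_star[OF y] y by (auto simp: Ysa dest: LIMSEQ_unique)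
  have ycomm: "v * y = y * v" if "v * h = h * v" for v
  proof -
    have "(\<lambda>n. v * Y n) \<longlonglongrightarrow> v * y" "(\<lambda>n. Y n * v) \<longlonglongrightarrow> y * v" by (intro tendsto_intros y)+
    then show ?thesis using Ycomm[OF that] LIMSEQ_unique by fastforce
  qed
  show thesis
  proof (rule that[OF _ _ root])
    show "star (1 - y) = 1 - y" "norm (1 - (1 - y)) \<le> 1" by (simp_all add: star_diff sy ny)
    show "v * (1 - y) = (1 - y) * v" if "v * h = h * v" for v
      using ycomm[OF that] by (simp add: algebra_simps)
  qed
qed

lemma positive_square_root:
  fixes h :: "'a::cstar_algebra"
  assumes "positive h"
  obtains s where "positive s" "s * s = h" "\<And>y. y * h = h * y \<Longrightarrow> y * s = s * y"
proof -
  from assms obtain t0 where sa: "star h = h" and t0: "norm (of_real t0 - h) \<le> t0"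
    unfolding positive_def by blast
  define t where "t = t0 + 1"
  have tpos: "t > 0" using t0 norm_ge_zero[of "of_real t0 - h"] unfolding t_def by linarith
  have "norm (of_real t - h) \<le> norm (of_real t0 - h) + norm (1::'a)"
    using norm_triangle_ineq[of "of_real t0 - h" 1] by (simp add: t_def algebra_simps)
  then have t: "norm (of_real t - h) \<le> t" using t0 by (simp add: t_def)
  have "1 - (1/t) *\<^sub>R h = (1/t) *\<^sub>R (of_real t - h)"
    using tpos by (simp add: scaleR_diff_right of_real_def)
  then have "norm (1 - (1/t) *\<^sub>R h) = (1/t) * norm (of_real t - h)"
    using tpos by simp
  then have le: "norm (1 - (1/t) *\<^sub>R h) \<le> 1" using t tpos by simp
  have sa': "star ((1/t) *\<^sub>R h) = (1/t) *\<^sub>R h" using sa by (simp add: star_scaleR)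
  then obtain s where s: "star s = s" "norm (1 - s) \<le> 1" "s * s = (1/t) *\<^sub>R h"
      and scomm: "\<And>y. y * ((1/t) *\<^sub>R h) = (1/t) *\<^sub>R h * y \<Longrightarrow> y * s = s * y"
    using square_root_near_one[OF sa' le] by blast
  have "positive s" unfolding positive_def using s by (auto intro: exI[of _ 1])
  then have "positive (sqrt t *\<^sub>R s)" using tpos by (intro positive_scaleR) auto
  moreover have "(sqrt t *\<^sub>R s) * (sqrt t *\<^sub>R s) = h" using s tpos by simp
  moreover have "y * (sqrt t *\<^sub>R s) = sqrt t *\<^sub>R s * y" if "y * h = h * y" for y
    using scomm[of y] that by simp
  ultimately show thesis using that by blast
qed

text \<open>
  The element $u = a + i b$ is unitary, hence of norm $1$, and $a = (u + u^*)/2$.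
\<close>

lemma norm_le_one_if_unit_circle:
  fixes a b :: "'a::cstar_algebra"
  assumes sa: "star a = a" "star b = b" and comm: "a * b = b * a" and one: "a * a + b * b = 1"
  shows "norm a \<le> 1"
proof -
  define u where "u = a + \<i> *\<^sub>C b"
  have su: "star u = a - \<i> *\<^sub>C b" by (simp add: u_def star_add star_scaleC sa)
  have "star u * u = a * a + b * b"
    unfolding su unfolding u_def
    by (simp add: algebra_simps mult_scaleC_left mult_scaleC_right scaleC_diff_right scaleC_scaleC
        comm scaleC_one)
  then have "(norm u)\<^sup>2 = 1" using one cstar_identity[of u] by simp
  then have "norm u = 1" by (simp add: power2_eq_1_iff) (use norm_ge_zero[of u] in linarith)
  moreover have "2 *\<^sub>R a = u + star u" by (simp add: su) (simp add: u_def scaleR_2)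
  then have "2 * norm a \<le> norm u + norm (star u)"
    using norm_triangle_ineq[of u "star u"] by (metis norm_scaleR abs_numeral)
  ultimately show ?thesis by simp
qed

text \<open>
  For $\|k\| \le 1$ the element $1 - k^2$ has a self-adjoint square root $s$ that commutes with $k$.
  Since $k^2 + s^2 = 1$, it satisfies $\|s\| \le 1$, and thus $\|1 - k^2\| = \|s^2\| \le 1$. The general
  case follows by scaling.
\<close>

lemma positive_square:
  fixes h :: "'a::cstar_algebra"
  assumes sa: "star h = h"
  shows "positive (h * h)"
proof (cases "h = 0")
  case False
  define k where "k = (1 / norm h) *\<^sub>R h"
  have k: "star k = k" "norm k = 1" using sa False by (auto simp: k_def star_scaleR)
  have "norm (1 - (1 - k * k)) \<le> 1" using norm_mult_ineq[of k k] k by simp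
  moreover have "star (1 - k * k) = 1 - k * k" using k by (simp add: star_diff star_mult)
  ultimately obtain s where s: "star s = s" "s * s = 1 - k * k"
      and scomm: "\<And>y. y * (1 - k * k) = (1 - k * k) * y \<Longrightarrow> y * s = s * y"
    using square_root_near_one by metis
  have "k * s = s * k" by (rule scomm) (simp add: algebra_simps)
  then have "norm s \<le> 1" using s k by (intro norm_le_one_if_unit_circle[of s k]) auto
  then have "norm (1 - k * k) \<le> 1" using norm_mult_ineq[of s s] s
    by (metis mult_le_one norm_ge_zero order_trans)
  then have "positive (k * k)" unfolding positive_def using k by (auto simp: star_mult intro: exI[of _ 1])
  then have "positive ((norm h)\<^sup>2 *\<^sub>R (k * k))" by (intro positive_scaleR) auto
  then show ?thesis using False by (simp add: k_def power2_eq_square)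
qed simp

lemma positive_mult:
  fixes a b :: "'a::cstar_algebra"
  assumes "positive a" "positive b" "a * b = b * a"
  shows "positive (a * b)"
proof -
  obtain s where s: "positive s" "s * s = a"
      and sc: "\<And>y. y * a = a * y \<Longrightarrow> y * s = s * y"
    using positive_square_root[OF assms(1)] by blast
  obtain r where r: "positive r" "r * r = b"
      and rc: "\<And>y. y * b = b * y \<Longrightarrow> y * r = r * y"
    using positive_square_root[OF assms(2)] by blast
  have sr: "s * r = r * s" using rc[of s] sc[of b] assms(3) by simp
  have "star (s * r) = s * r" using sr positive_star[OF s(1)] positive_star[OF r(1)] by (simp add: star_mult)
  then have "positive ((s * r) * (s * r))" by (rule positive_square)
  moreover have "(s * r) * (s * r) = a * b" using sr s(2) r(2) by (metis mult.assoc)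
  ultimately show ?thesis by simp
qed

text \<open>
  The product $(1 + b)(1 - b) = 1 - b^2$ of commuting positive elements is a square $m^2$, so that
  $b^2 + m^2 = 1$.
\<close>

lemma norm_le_one_if_order_bounded:
  fixes b :: "'a::cstar_algebra"
  assumes "positive (1 + b)" "positive (1 - b)"
  shows "norm b \<le> 1"
proof -
  have sab: "star b = b" using positive_star[OF assms(1)] by (simp add: star_add)
  have "positive ((1 + b) * (1 - b))" by (rule positive_mult[OF assms]) (simp add: algebra_simps)
  then have "positive (1 - b * b)" by (simp add: algebra_simps)
  then obtain m where m: "positive m" "m * m = 1 - b * b"
      and scomm: "\<And>y. y * (1 - b * b) = (1 - b * b) * y \<Longrightarrow> y * m = m * y"
    using positive_square_root by metis
  show ?thesis
  proof (rule norm_le_one_if_unit_circle[of b m])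
    show "b * m = m * b" by (rule scomm) (simp add: algebra_simps)
  qed (use sab m positive_star in auto)
qed

lemma norm_le_if_positive_diff:
  fixes a :: "'a::cstar_algebra"
  assumes a: "positive a" and ta: "positive (of_real t - a)"
  shows "norm a \<le> t"
proof -
  have "positive (of_real t :: 'a)" using positive_add[OF a ta] by simp
  then have t0: "0 \<le> t" by simp
  have "norm a \<le> s" if "t < s" for s
  proof -
    have s: "s > 0" using t0 that by simp
    have "positive (of_real (s - t) + (of_real t - a))" using that by (intro positive_add ta) (simp only: positive_of_real_iff)
    then have sa: "positive (of_real s - a)" by (simp add: algebra_simps)
    define b where "b = (2/s) *\<^sub>R a - 1"
    have "1 + b = (2/s) *\<^sub>R a" by (simp add: b_def)
    then have 1: "positive (1 + b)" using a s by (simp add: positive_scaleR)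
    have "1 - b = (2/s) *\<^sub>R (of_real s - a)" using s by (simp add: b_def scaleR_diff_right of_real_def scaleR_2)
    then have 2: "positive (1 - b)" using sa s by (simp add: positive_scaleR)
    have "norm (1 + b) \<le> 2" using norm_le_one_if_order_bounded[OF 1 2] norm_triangle_ineq[of 1 b] by simp
    then have "norm ((2/s) *\<^sub>R a) \<le> 2" by (simp add: b_def)
    then show ?thesis using s by (simp add: field_simps)
  qed
  then show ?thesis by (rule dense_ge)
qed

text \<open>
  The inverse $d$ is at most $\|d\|$; multiplication by the commuting positive element $c$ turns this
  into $1 \le \|d\| c$.
\<close>

lemma positive_invertible_bounded_below:
  fixes c d :: "'a::cstar_algebra"
  assumes c: "positive c" and cd: "c * d = 1"
  obtains \<delta> where "\<delta> > 0" "positive (c - of_real \<delta>)"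
proof -
  have sc: "star c = c" using c by (rule positive_star)
  have dc': "star d * c = 1" using arg_cong[OF cd, of star] by (simp add: star_mult sc)
  then have sd: "star d = d" using cd by (metis mult.assoc mult.right_neutral mult_1)
  then have dc: "d * c = 1" using dc' by simp
  have d0: "d \<noteq> 0" using cd by auto
  define R where "R = norm d"
  have R: "R > 0" using d0 by (simp add: R_def)
  have "positive (of_real R - d)" using sd by (intro positive_of_real_diff) (auto simp: R_def)
  then have "positive ((of_real R - d) * c)" using c by (rule positive_mult) (simp add: algebra_simps cd dc of_real_def)
  then have "positive ((1/R) *\<^sub>R ((of_real R - d) * c))" using R by (intro positive_scaleR) auto
  moreover have "(1/R) *\<^sub>R ((of_real R - d) * c) = c - of_real (1/R)"
    using R dc by (simp add: left_diff_distrib scaleR_diff_right) (simp add: of_real_def)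
  ultimately show thesis using R that[of "1/R"] by simp
qed

text \<open>
  If $\|r - p\| \le r$, then $(T + p)/(T + r)$ has distance at most $r/(T + r) < 1$ from $1$, so it is
  inverted by a geometric series.
\<close>

lemma of_real_add_positive_invertible:
  fixes p :: "'a::cstar_algebra"
  assumes "positive p" "T > 0"
  obtains e where "(of_real T + p) * e = 1"
proof -
  from assms obtain r where r: "norm (of_real r - p) \<le> r" unfolding positive_def by blast
  define R where "R = T + r"
  have r0: "r \<ge> 0" using r norm_ge_zero order_trans by blast
  then have R: "R > 0" using assms by (simp add: R_def)
  define w where "w = (1/R) *\<^sub>R (of_real r - p)"
  have "norm w = (1/R) * norm (of_real r - p)" using R by (simp add: w_def add: scaleR_diff_right[symmetric])
  also have "\<dots> \<le> r / R" using r R by (simp add: divide_right_mono)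
  also have "\<dots> < 1" using R assms by (simp add: R_def)
  finally have "norm w < 1" .
  then have sm: "summable (\<lambda>n. w ^ n)" by (rule complete_algebra_summable_geometric)
  have "(\<Sum>n. w ^ n) = 1 + w * (\<Sum>n. w ^ n)"
    using suminf_split_head[OF sm] suminf_mult[OF sm, of w] by simp
  then have e: "(1 - w) * (\<Sum>n. w ^ n) = 1" by (simp add: algebra_simps)
  have "R *\<^sub>R w = of_real r - p" using R by (simp add: w_def)
  then have "of_real T + p = R *\<^sub>R (1 - w)"
    by (simp add: scaleR_diff_right) (simp add: R_def of_real_def scaleR_add_left)
  then show thesis using e R that[of "(1/R) *\<^sub>R (\<Sum>n. w ^ n)"] by simp
qed

text \<open>
  Multiplying in the other order keeps the nonzero spectrum but reverses the sign here: $y^* y$ is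
  negative, so $T - y^* y$ is invertible for every $T > 0$, and then so is $T - y y^*$. On
  the other hand $a = y y^*$ is positive, because the sum $y y^* + y^* y$ is a sum of squares. For
  $T = \|a\|$ the invertible positive element $T - a$ is bounded below by some $\delta > 0$, which gives
  $\|a\| \le T - \delta$, a contradiction.
\<close>

lemma zero_if_star_mult_self_negative:
  fixes y :: "'a::cstar_algebra"
  assumes p: "positive p" and yy: "star y * y = - p"
  shows "y = 0"
proof (rule ccontr)
  assume "y \<noteq> 0"
  define T where "T = (norm y)\<^sup>2"
  define a where "a = y * star y"
  have T: "T > 0" using \<open>y \<noteq> 0\<close> by (simp add: T_def)
  have sa: "star a = a" by (simp add: a_def star_mult star_star)
  have na: "norm a = T" using cstar_identity[of "star y"] by (simp add: a_def T_def star_star)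
  define u where "u = y + star y"
  define v where "v = \<i> *\<^sub>C (star y - y)"
  have uv: "star u = u" "star v = v" 
    by (simp_all add: u_def v_def star_add star_scaleC star_diff star_star add.commute scaleC_diff_right)
  have "v * v = - ((star y - y) * (star y - y))"
    by (simp add: v_def mult_scaleC_left mult_scaleC_right scaleC_scaleC scaleC_one)
  then have "u * u + v * v = 2 *\<^sub>R (a + star y * y)"
    by (simp add: u_def a_def algebra_simps scaleR_2)
  then have "(1/2) *\<^sub>R (u * u + v * v) = a + star y * y" by simp
  then have a: "a = (1/2) *\<^sub>R (u * u + v * v) + p" using yy by simp
  have pa: "positive a" unfolding a using p uv by (intro positive_add positive_scaleR positive_square) auto
  have pc: "positive (of_real T - a)" using sa na by (intro positive_of_real_diff) auto
  obtain e where e: "(of_real T + p) * e = 1" using of_real_add_positive_invertible[OF p T] by blast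
  \<comment> \<open>If e inverts T - y* y, then (1 + y e y*)/T inverts T - y y*.\<close>
  have "(of_real T - a) * (1 + y * e * star y) = of_real T - a + of_real T * (y * e * star y) - y * (star y * y) * e * star y"
    by (simp add: a_def algebra_simps)
  also have "\<dots> = of_real T - a + y * ((of_real T + p) * e) * star y"
    unfolding yy by (simp add: algebra_simps of_real_def)
  also have "\<dots> = of_real T" using e by (simp add: a_def)
  finally have "(of_real T - a) * ((1/T) *\<^sub>R (1 + y * e * star y)) = 1" using T by (simp add: of_real_def)
  then obtain \<delta> where \<delta>: "\<delta> > 0" "positive (of_real T - a - of_real \<delta>)"
    using positive_invertible_bounded_below[OF pc] by blast
  then have "positive (of_real (T - \<delta>) - a)" by (simp add: algebra_simps)
  then have "norm a \<le> T - \<delta>" by (rule norm_le_if_positive_diff[OF pa])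
  then show False using na \<delta> by simp
qed

lemma star_mult_self_eq_0: "star x * x = 0 \<longleftrightarrow> x = (0::'a::cstar_algebra)"
  using cstar_identity[of x] by auto

text \<open>
  Let $k$ be the absolute value of $h = x^* x$, that is, the positive root of $h^2$, and $g = k - h$,
  which is twice the negative part of $h$. Then $h g = -k g$, so
  $(x g)^* (x g) = g h g = -k g^2$ is negative. An element whose $y^* y$ is negative vanishes, so $x g = 0$, which forces $g = 0$
  and $h = k$.
\<close>

lemma positive_star_mult_self:
  fixes x :: "'a::cstar_algebra"
  shows "positive (star x * x)"
proof -
  define h where "h = star x * x"
  have sh: "star h = h" by (simp add: h_def star_mult star_star)
  obtain k where k: "positive k" "k * k = h * h"
      and scomm: "\<And>y. y * (h * h) = h * h * y \<Longrightarrow> y * k = k * y"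
    using positive_square_root[OF positive_square[OF sh]] by blast
  have hk: "h * k = k * h" by (rule scomm) (simp add: mult.assoc)
  define g where "g = k - h"
  have sg: "star g = g" using positive_star[OF k(1)] by (simp add: g_def star_diff sh)
  have kg: "k * g = g * k" using hk by (simp add: g_def algebra_simps)
  have hg: "h * g = - (k * g)" by (simp add: g_def right_diff_distrib hk k(2))
  have pos: "positive (k * (g * g))"
    by (rule positive_mult[OF k(1) positive_square[OF sg]]) (metis kg mult.assoc)
  have "star (x * g) * (x * g) = g * (h * g)" by (simp add: star_mult sg h_def mult.assoc)
  also have "\<dots> = - (k * (g * g))" by (simp only: hg mult_minus_right) (metis kg mult.assoc)
  finally have neg: "star (x * g) * (x * g) = - (k * (g * g))" .
  then have "x * g = 0" by (rule zero_if_star_mult_self_negative[OF pos])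
  then have hg0: "h * g = 0" by (simp add: h_def mult.assoc)
  then have "star g * g = 0" unfolding sg using hg by (simp add: g_def left_diff_distrib)
  then have "g = 0" by (simp add: star_mult_self_eq_0)
  then show ?thesis using k(1) by (simp add: g_def h_def)
qed

section \<open>Positive functionals from convex cones\<close>

text \<open>
  The Hahn-Banach theorem in the form of M. Riesz. A cone $M \supseteq K$ maximal among those without
  $-u$ is total: if $x \notin M$, then $-u$ lies in the cone generated by $M$ and $x$, and solving for
  $x$ shows $-x \in M$. Thus $x$ and the multiples $t u$ are comparable for every $t$, which cuts the
  real line at one number $f(x)$. It is subadditive when read as an infimum and superadditive when
  read as a supremum.
\<close>

lemma positive_functional_extension:
  fixes K :: "'v::real_vector set" and u :: 'v
  assumes add: "\<And>x y. x \<in> K \<Longrightarrow> y \<in> K \<Longrightarrow> x + y \<in> K"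
    and scale: "\<And>c x. 0 \<le> c \<Longrightarrow> x \<in> K \<Longrightarrow> c *\<^sub>R x \<in> K"
    and unit: "\<And>x. \<exists>t. t *\<^sub>R u - x \<in> K" and u: "u \<in> K" and proper: "- u \<notin> K"
  obtains f :: "'v \<Rightarrow> real" where "linear f" "f u = 1" "\<And>x. x \<in> K \<Longrightarrow> 0 \<le> f x"
proof -
  define \<C> where "\<C> = {L. K \<subseteq> L \<and> (\<forall>x\<in>L. \<forall>y\<in>L. x + y \<in> L) \<and> (\<forall>c\<ge>0. \<forall>x\<in>L. c *\<^sub>R x \<in> L) \<and> - u \<notin> L}"
  have "\<exists>M\<in>\<C>. \<forall>X\<in>\<C>. M \<subseteq> X \<longrightarrow> X = M"
  proof (rule subset_Zorn_nonempty)
    have "K \<in> \<C>" using add scale proper by (auto simp: \<C>_def)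
    then show "\<C> \<noteq> {}" by blast
    fix \<D> assume ne: "\<D> \<noteq> {}" and ch: "subset.chain \<C> \<D>"
    have "x + y \<in> \<Union>\<D>" if xy: "x \<in> \<Union>\<D>" "y \<in> \<Union>\<D>" for x y
    proof -
      from xy obtain X Y where XY: "X \<in> \<D>" "Y \<in> \<D>" "x \<in> X" "y \<in> Y" by blast
      then obtain Z where "Z \<in> \<D>" "x \<in> Z" "y \<in> Z" using ch unfolding subset_chain_def by blast
      moreover from this have "Z \<in> \<C>" using ch unfolding subset_chain_def by blast
      ultimately show ?thesis unfolding \<C>_def by blast
    qed
    moreover have "c *\<^sub>R x \<in> \<Union>\<D>" if "0 \<le> c" "x \<in> \<Union>\<D>" for c x
      using that ch unfolding subset_chain_def \<C>_def by blast
    moreover have DC: "K \<subseteq> X \<and> - u \<notin> X" if "X \<in> \<D>" for X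
      using that ch unfolding subset_chain_def \<C>_def by blast
    then have "K \<subseteq> \<Union>\<D>" "- u \<notin> \<Union>\<D>" using ne by blast+
    ultimately show "\<Union>\<D> \<in> \<C>" unfolding \<C>_def by simp
  qed
  then obtain M where M: "M \<in> \<C>" and max: "\<And>X. X \<in> \<C> \<Longrightarrow> M \<subseteq> X \<Longrightarrow> X = M" by blast
  have KM: "K \<subseteq> M" and madd: "\<And>x y. x \<in> M \<Longrightarrow> y \<in> M \<Longrightarrow> x + y \<in> M"
    and mscale: "\<And>c x. 0 \<le> c \<Longrightarrow> x \<in> M \<Longrightarrow> c *\<^sub>R x \<in> M" and mu: "- u \<notin> M"
    using M unfolding \<C>_def by auto
  have uM: "u \<in> M" using u KM by blast
  have total: "- x \<in> M" if "x \<notin> M" for x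
  proof -
    define L where "L = {k + s *\<^sub>R x | k s. k \<in> M \<and> 0 \<le> s}"
    have in_L: "k + s *\<^sub>R x \<in> L" if "k \<in> M" "0 \<le> s" for k s using that unfolding L_def by blast
    have "M \<subseteq> L" using in_L[of _ 0] by auto
    moreover have "0 \<in> M" using mscale[of 0 u] uM by simp
    then have "x \<in> L" using in_L[of 0 1] by simp
    ultimately have "L \<notin> \<C>" using max that by blast
    moreover have "y + z \<in> L" if "y \<in> L" "z \<in> L" for y z
    proof -
      from that obtain k s k' s' where *: "y = k + s *\<^sub>R x" "z = k' + s' *\<^sub>R x" "k \<in> M" "k' \<in> M" "0 \<le> s" "0 \<le> s'"
        unfolding L_def by blast
      then have "y + z = (k + k') + (s + s') *\<^sub>R x" by (simp add: algebra_simps)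
      also have "\<dots> \<in> L" using * by (intro in_L madd) auto
      finally show ?thesis .
    qed
    moreover have "c *\<^sub>R y \<in> L" if "0 \<le> c" "y \<in> L" for c y
    proof -
      from that obtain k s where *: "y = k + s *\<^sub>R x" "k \<in> M" "0 \<le> s" unfolding L_def by blast
      then have "c *\<^sub>R y = c *\<^sub>R k + (c * s) *\<^sub>R x" by (simp add: algebra_simps)
      also have "\<dots> \<in> L" using * that by (intro in_L mscale) auto
      finally show ?thesis .
    qed
    ultimately have "- u \<in> L" using KM \<open>M \<subseteq> L\<close> unfolding \<C>_def by blast
    then obtain k s where ks: "- u = k + s *\<^sub>R x" "k \<in> M" "0 \<le> s" unfolding L_def by blast
    then have "s \<noteq> 0" using mu by auto
    have "s *\<^sub>R x = - u - k" using ks(1) by simp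
    then have "s *\<^sub>R (- x) = u + k" by simp
    then have "- x = (1/s) *\<^sub>R (u + k)" using \<open>s \<noteq> 0\<close> by (metis divide_self_if scaleR_one scaleR_scaleR times_divide_eq_left mult_1)
    then show ?thesis using mscale[of "1/s" "u + k"] madd[OF uM ks(2)] ks(3) by simp
  qed
  define B where "B x = {t. t *\<^sub>R u - x \<in> M}" for x
  define f where "f x = Inf (B x)" for x
  have neg: "\<not> c *\<^sub>R u \<in> M" if "c < 0" for c
    using mscale[of "- 1/c" "c *\<^sub>R u"] that mu by auto
  have sep: "s \<le> t" if "x - s *\<^sub>R u \<in> M" "t *\<^sub>R u - x \<in> M" for x s t
  proof (rule ccontr)
    assume "\<not> s \<le> t"
    moreover have "(t - s) *\<^sub>R u \<in> M" using madd[OF that] by (simp add: algebra_simps)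
    ultimately show False using neg[of "t - s"] by simp
  qed
  have Bne: "B x \<noteq> {}" for x using unit[of x] KM by (auto simp: B_def)
  have lower: "\<exists>s. x - s *\<^sub>R u \<in> M" for x
  proof -
    obtain t where "t *\<^sub>R u - (- x) \<in> M" using Bne[of "- x"] by (auto simp: B_def)
    then show ?thesis by (intro exI[of _ "- t"]) (simp add: algebra_simps)
  qed
  have Bbdd: "bdd_below (B x)" for x
  proof -
    obtain s where "x - s *\<^sub>R u \<in> M" using lower by blast
    then show ?thesis using sep by (auto simp: B_def bdd_below_def)
  qed
  have f_le: "f x \<le> t" if "t *\<^sub>R u - x \<in> M" for x t
    using that Bbdd unfolding f_def B_def by (auto intro: cInf_lower)
  have f_ge: "s \<le> f x" if "x - s *\<^sub>R u \<in> M" for x s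
    using that Bne sep unfolding f_def by (intro cInf_greatest) (auto simp: B_def)
  have below: "t *\<^sub>R u - x \<in> M" if "f x < t" for x t
  proof -
    have "Inf (B x) < t" using that by (simp only: f_def)
    then obtain r where r: "r \<in> B x" "r < t" using cInf_lessD[OF Bne] by blast
    have "(t - r) *\<^sub>R u \<in> M" using r(2) by (intro mscale uM) simp
    then have "(r *\<^sub>R u - x) + (t - r) *\<^sub>R u \<in> M" using r(1) by (intro madd) (simp_all add: B_def)
    then show ?thesis by (simp add: algebra_simps)
  qed
  have above: "x - s *\<^sub>R u \<in> M" if "s < f x" for x s
    using f_le[of s x] total[of "s *\<^sub>R u - x"] that by auto
  have f_add: "f (x + y) = f x + f y" for x y
  proof (rule antisym; rule field_le_epsilon)
    fix e :: real assume e: "0 < e"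
    have half: "(e/2) *\<^sub>R u + (e/2) *\<^sub>R u = e *\<^sub>R u" by (simp flip: scaleR_add_left)
    have "(f x + e/2) *\<^sub>R u - x + ((f y + e/2) *\<^sub>R u - y) \<in> M" using e by (intro madd below) auto
    moreover have "(f x + e/2) *\<^sub>R u - x + ((f y + e/2) *\<^sub>R u - y) = (f x + f y + e) *\<^sub>R u - (x + y)"
      using half by (simp add: algebra_simps)
    ultimately have "(f x + f y + e) *\<^sub>R u - (x + y) \<in> M" by simp
    then show "f (x + y) \<le> f x + f y + e" by (rule f_le)
    have "x - (f x - e/2) *\<^sub>R u + (y - (f y - e/2) *\<^sub>R u) \<in> M" using e by (intro madd above) auto
    moreover have "x - (f x - e/2) *\<^sub>R u + (y - (f y - e/2) *\<^sub>R u) = (x + y) - (f x + f y - e) *\<^sub>R u"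
      using half by (simp add: algebra_simps)
    ultimately have "f x + f y - e \<le> f (x + y)" using f_ge by metis
    then show "f x + f y \<le> f (x + y) + e" by simp
  qed
  have f_pos: "0 \<le> f x" if "x \<in> M" for x using f_ge[of x 0] that by simp
  have f_scale_pos: "f (c *\<^sub>R x) = c * f x" if c: "0 < c" for c x
  proof (rule antisym; rule field_le_epsilon)
    fix e :: real assume e: "0 < e"
    have "c *\<^sub>R ((f x + e/c) *\<^sub>R u - x) \<in> M" using e c by (intro mscale below) auto
    moreover have "c *\<^sub>R ((f x + e/c) *\<^sub>R u - x) = (c * f x + e) *\<^sub>R u - c *\<^sub>R x"
      using c by (simp add: scaleR_diff_right distrib_left)
    ultimately show "f (c *\<^sub>R x) \<le> c * f x + e" using f_le by metis
    have "c *\<^sub>R (x - (f x - e/c) *\<^sub>R u) \<in> M" using e c by (intro mscale above) auto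
    moreover have "c *\<^sub>R (x - (f x - e/c) *\<^sub>R u) = c *\<^sub>R x - (c * f x - e) *\<^sub>R u"
      using c by (simp add: scaleR_diff_right right_diff_distrib)
    ultimately have "c * f x - e \<le> f (c *\<^sub>R x)" using f_ge by metis
    then show "c * f x \<le> f (c *\<^sub>R x) + e" by simp
  qed
  have f0: "f 0 = 0" using f_add[of 0 0] by simp
  have f_minus: "f (- x) = - f x" for x using f_add[of x "- x"] f0 by simp
  have f_scale: "f (c *\<^sub>R x) = c * f x" for c x
  proof (cases c "0::real" rule: linorder_cases)
    case less
    then show ?thesis using f_scale_pos[of "- c" x] by (simp add: f_minus)
  qed (auto simp: f0 f_scale_pos)
  have "0 \<in> M" using mscale[of 0 u] uM by simp
  then have "f u = 1" using f_le[of 1 u] f_ge[of u 1] by simp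
  moreover have "linear f" using f_add f_scale by (intro linearI) auto
  ultimately show thesis using that f_pos KM by blast
qed

section \<open>Cesaro means of a linear map\<close>

definition cesaro :: "('v::real_vector \<Rightarrow> 'v) \<Rightarrow> nat \<Rightarrow> 'v \<Rightarrow> 'v" where
  "cesaro U n x = (1 / real n) *\<^sub>R (\<Sum>k<n. (U ^^ k) x)"

lemma linear_funpow:
  fixes U :: "'v::real_vector \<Rightarrow> 'v"
  shows "linear U \<Longrightarrow> linear (U ^^ k)"
  by (induction k) (auto simp: linear_iff)

lemma linear_cesaro: "linear U \<Longrightarrow> linear (cesaro U n)"
  unfolding cesaro_def
  by (rule linearI)
    (simp_all add: linear_add[OF linear_funpow] linear_scale[OF linear_funpow] sum.distrib scaleR_sum_right
      scaleR_add_right mult.commute)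

lemma norm_funpow_le:
  fixes U :: "'v::real_normed_vector \<Rightarrow> 'v"
  assumes "\<And>x. norm (U x) \<le> norm x"
  shows "norm ((U ^^ k) x) \<le> norm x"
  by (induction k) (auto intro: order_trans[OF assms])

lemma norm_cesaro_le:
  assumes "\<And>x::'v::real_normed_vector. norm (U x) \<le> norm x"
  shows "norm (cesaro U n x) \<le> norm x"
proof (cases "n = 0")
  case False
  have "norm (\<Sum>k<n. (U ^^ k) x) \<le> real n * norm x"
    using sum_norm_bound[of "{..<n}" "\<lambda>k. (U ^^ k) x" "norm x"] norm_funpow_le[of U, OF assms] by simp
  then show ?thesis using False by (simp add: cesaro_def field_simps)
qed (simp add: cesaro_def)

lemma cesaro_shift:
  assumes "linear U"
  shows "cesaro U n (U x) - cesaro U n x = (1 / real n) *\<^sub>R ((U ^^ n) x - x)"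
proof -
  have "(\<Sum>k<n. (U ^^ k) (U x)) - (\<Sum>k<n. (U ^^ k) x) = (U ^^ n) x - x"
    using sum_lessThan_telescope[of "\<lambda>k. (U ^^ k) x" n] by (simp add: funpow_swap1 sum_subtractf)
  then show ?thesis by (simp add: cesaro_def flip: scaleR_diff_right)
qed

text \<open>
  The sums of $U^k(U x)$ and of $U^k x$ telescope to a difference of two vectors of bounded norm.
\<close>

lemma cesaro_shift_tendsto:
  assumes lin: "linear U" and le: "\<And>x::'v::real_normed_vector. norm (U x) \<le> norm x"
  shows "(\<lambda>N. cesaro U N (U x) - cesaro U N x) \<longlonglongrightarrow> 0"
proof (rule Lim_null_comparison)
  show "\<forall>\<^sub>F N in sequentially. norm (cesaro U N (U x) - cesaro U N x) \<le> 2 * norm x / real N"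
  proof (intro always_eventually allI)
    fix N
    have "norm ((U ^^ N) x - x) \<le> 2 * norm x"
      using norm_triangle_ineq4[of "(U ^^ N) x" x] norm_funpow_le[of U N x, OF le] by simp
    then show "norm (cesaro U N (U x) - cesaro U N x) \<le> 2 * norm x / real N"
      by (simp add: cesaro_shift[OF lin] divide_right_mono)
  qed
  show "(\<lambda>N. 2 * norm x / real N) \<longlonglongrightarrow> 0" by (rule lim_const_over_n)
qed

text \<open>
  Each $U^k x$ has asymptotically the same means as $x$, hence so has the average of $x, U x, \dots,
  U^{n-1} x$. The case $n = 0$ is excluded because that mean is $0$ by convention.
\<close>

lemma cesaro_cesaro_tendsto:
  assumes lin: "linear U" and le: "\<And>x::'v::real_normed_vector. norm (U x) \<le> norm x" and n: "0 < n"
  shows "(\<lambda>N. cesaro U N (cesaro U n x) - cesaro U N x) \<longlonglongrightarrow> 0"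
proof -
  have pow: "(\<lambda>N. cesaro U N ((U ^^ k) x) - cesaro U N x) \<longlonglongrightarrow> 0" for k
  proof (induction k)
    case (Suc k)
    show ?case using tendsto_add[OF cesaro_shift_tendsto[OF lin le, of "(U ^^ k) x"] Suc] by simp
  qed simp
  have "cesaro U N (cesaro U n x) - cesaro U N x
      = (1 / real n) *\<^sub>R (\<Sum>k<n. cesaro U N ((U ^^ k) x) - cesaro U N x)" for N
  proof -
    have "cesaro U N (cesaro U n x) = (1 / real n) *\<^sub>R (\<Sum>k<n. cesaro U N ((U ^^ k) x))"
      unfolding cesaro_def[of U n x]
      by (simp add: linear_scale[OF linear_cesaro[OF lin]] linear_sum[OF linear_cesaro[OF lin]] o_def)
    then show ?thesis using n by (simp add: sum_subtractf scaleR_diff_right scaleR_conv_of_real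
          flip: sum_constant_scaleR) (simp add: sum_constant_scaleR)
  qed
  then show ?thesis using tendsto_scaleR[OF tendsto_const tendsto_sum[of "{..<n}", OF pow], of "1 / real n"]
    by simp
qed

section \<open>Star homomorphisms and their means\<close>

lemma unital_star_homD:
  assumes "unital_star_hom \<Phi>"
  shows "\<Phi> (x + y) = \<Phi> x + \<Phi> y" "\<Phi> (c *\<^sub>C x) = c *\<^sub>C \<Phi> x" "\<Phi> (x * y) = \<Phi> x * \<Phi> y"
    "\<Phi> (star x) = star (\<Phi> x)" "\<Phi> 1 = 1"
  using assms unfolding unital_star_hom_def by blast+

lemma linear_unital_star_hom: "unital_star_hom \<Phi> \<Longrightarrow> linear \<Phi>"
  by (rule linearI) (auto simp: unital_star_homD scaleR_scaleC)

lemma unital_star_hom_funpow: "unital_star_hom (\<Phi> :: 'a::cstar_algebra \<Rightarrow> 'a) \<Longrightarrow> unital_star_hom (\<Phi> ^^ k)"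
  by (induction k) (auto simp: unital_star_hom_def)

lemma positive_unital_star_hom:
  assumes "unital_star_hom \<Phi>" "positive h"
  shows "positive (\<Phi> h)"
proof -
  obtain s where s: "positive s" "s * s = h" using positive_square_root[OF assms(2)] by blast
  then have "\<Phi> h = star (\<Phi> s) * \<Phi> s"
    using unital_star_homD(3,4)[OF assms(1)] positive_star[OF s(1)] by metis
  then show ?thesis by (simp add: positive_star_mult_self)
qed

text \<open>
  Contractivity comes from the order: $\|x\|^2 - x^* x$ is positive, and its image
  $\|x\|^2 - \Phi(x)^* \Phi(x)$ is positive again.
\<close>

lemma norm_unital_star_hom_le:
  assumes hom: "unital_star_hom \<Phi>"
  shows "norm (\<Phi> x) \<le> norm x"
proof -
  note D = unital_star_homD[OF hom]
  have "positive (of_real ((norm x)\<^sup>2) - star x * x)"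
    by (rule positive_of_real_diff) (simp_all add: star_mult star_star cstar_identity)
  then have "positive (\<Phi> (of_real ((norm x)\<^sup>2) - star x * x))" by (rule positive_unital_star_hom[OF hom])
  also have "\<Phi> (of_real ((norm x)\<^sup>2) - star x * x) = of_real ((norm x)\<^sup>2) - star (\<Phi> x) * \<Phi> x"
    by (simp add: linear_diff[OF linear_unital_star_hom[OF hom]] of_real_def D
        linear_scale[OF linear_unital_star_hom[OF hom]])
  finally have "norm (star (\<Phi> x) * \<Phi> x) \<le> (norm x)\<^sup>2"
    by (intro norm_le_if_positive_diff positive_star_mult_self)
  then show ?thesis by (simp add: cstar_identity power2_le_iff_abs_le)
qed

lemma positive_cesaro:
  assumes "unital_star_hom \<Phi>" "positive h"
  shows "positive (cesaro \<Phi> n h)"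
  unfolding cesaro_def
  by (intro positive_scaleR positive_sum positive_unital_star_hom[OF unital_star_hom_funpow] assms) auto

lemma cesaro_one:
  assumes "unital_star_hom \<Phi>" "0 < n"
  shows "cesaro \<Phi> n 1 = (1 :: 'a::cstar_algebra)"
proof -
  have "(\<Sum>k<n. (\<Phi> ^^ k) 1) = real n *\<^sub>R (1 :: 'a)"
    by (simp add: unital_star_homD(5)[OF unital_star_hom_funpow[OF assms(1)]] scaleR_conv_of_real)
  then show ?thesis using assms(2) by (simp add: cesaro_def)
qed

text \<open>
  The difference is the variance, the mean of $(y_k - m)^* (y_k - m)$ with $m$ the mean of the $y_k$.
\<close>

lemma positive_variance:
  fixes y :: "nat \<Rightarrow> 'a::cstar_algebra"
  defines "m \<equiv> \<lambda>n. (1 / real n) *\<^sub>R (\<Sum>k<n. y k)"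
  shows "positive ((1 / real n) *\<^sub>R (\<Sum>k<n. star (y k) * y k) - star (m n) * m n)"
proof (cases "n = 0")
  case False
  define S where "S = (\<Sum>k<n. y k)"
  have mS: "m n = (1 / real n) *\<^sub>R S" by (simp add: m_def S_def)
  have "(\<Sum>k<n. star (y k - m n) * (y k - m n))
      = (\<Sum>k<n. star (y k) * y k) - star S * m n - star (m n) * S + real n *\<^sub>R (star (m n) * m n)"
    by (simp add: star_diff algebra_simps sum.distrib sum_subtractf star_sum S_def
        sum_distrib_left sum_distrib_right scaleR_conv_of_real)
  also have "\<dots> = (\<Sum>k<n. star (y k) * y k) - real n *\<^sub>R (star (m n) * m n)"
    using False by (simp add: mS star_scaleR)
  finally have "(1 / real n) *\<^sub>R (\<Sum>k<n. star (y k) * y k) - star (m n) * m n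
      = (1 / real n) *\<^sub>R (\<Sum>k<n. star (y k - m n) * (y k - m n))"
    using False by (simp add: scaleR_diff_right)
  also have "positive \<dots>" by (intro positive_scaleR positive_sum positive_star_mult_self) auto
  finally show ?thesis .
qed (simp add: m_def)

text \<open>
  For an eigenvalue $z$ and $w = z^{-1}$, eigenvectors become fixed vectors of $w \Phi$, which reduces
  the theorem to ordinary ergodic means.
\<close>

definition twist :: "complex \<Rightarrow> ('a \<Rightarrow> 'a) \<Rightarrow> 'a \<Rightarrow> 'a::cstar_algebra" where
  "twist w \<Phi> x = w *\<^sub>C \<Phi> x"

context
  fixes \<Phi> :: "'a::cstar_algebra \<Rightarrow> 'a" and w :: complex
  assumes hom: "unital_star_hom \<Phi>" and w: "cmod w = 1"
begin

lemma linear_twist: "linear (twist w \<Phi>)"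
  by (rule linearI) (auto simp: twist_def unital_star_homD[OF hom] scaleR_scaleC scaleC_add_right scaleC_scaleC mult.commute)

lemma norm_twist_le: "norm (twist w \<Phi> x) \<le> norm x"
  by (simp add: twist_def norm_scaleC w norm_unital_star_hom_le[OF hom])

lemma twist_funpow: "(twist w \<Phi> ^^ k) x = w ^ k *\<^sub>C (\<Phi> ^^ k) x"
  by (induction k) (auto simp: twist_def unital_star_homD[OF hom] scaleC_scaleC scaleC_one mult.commute)

lemma star_mult_twist_funpow: "star ((twist w \<Phi> ^^ k) x) * (twist w \<Phi> ^^ k) x = (\<Phi> ^^ k) (star x * x)"
proof -
  have "cnj (w ^ k) * w ^ k = 1"
    using w by (simp add: complex_norm_square[symmetric] mult.commute norm_power flip: complex_cnj_power)
  then show ?thesis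
    by (simp add: twist_funpow star_scaleC mult_scaleC_left mult_scaleC_right scaleC_scaleC scaleC_one mult.commute
        unital_star_homD[OF unital_star_hom_funpow[OF hom]])
qed

lemma positive_cesaro_variance:
  "positive (cesaro \<Phi> n (star x * x) - star (cesaro (twist w \<Phi>) n x) * cesaro (twist w \<Phi>) n x)"
  using positive_variance[where y = "\<lambda>k. (twist w \<Phi> ^^ k) x" and n = n]
  by (simp only: star_mult_twist_funpow cesaro_def)

text \<open>
  Let $A_n$ be the $n$-th mean along $\Phi$ and $M_n$ the $n$-th twisted mean of $a$. The cone $K$ consists of all
  $x$ such that, for some $C \ge 0$ and along those $n$ with $\|M_n\| \ge \varepsilon$, the element
  $A_n(x + x^*) - C (M_n^* M_n - \varepsilon^2)$ is asymptotically positive. It is made to contain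
  everything on which the state has to be nonnegative: with $C = 0$, positive and skew-adjoint
  elements and all $\pm(\Phi(x) - x)$; with $C = 2$, the elements $M_m^* M_m - \varepsilon^2$. If $-1$
  belonged to $K$, then $C M_n^* M_n$ would be bounded by $C \varepsilon^2 - 1$ for some of these $n$,
  against $\|M_n^* M_n\| \ge \varepsilon^2$. A linear functional $f$ that is nonnegative on $K$ is the real part of the
  state.
\<close>

lemma invariant_state_exists:
  fixes a :: 'a
  assumes \<epsilon>: "0 < \<epsilon>" and freq: "\<exists>\<^sub>F n in sequentially. \<epsilon> \<le> norm (cesaro (twist w \<Phi>) n a)"
  obtains \<phi> where "\<phi> \<in> invariant_states \<Phi>"
    "\<And>m. 0 < m \<Longrightarrow> \<epsilon>\<^sup>2 \<le> Re (\<phi> (star (cesaro (twist w \<Phi>) m a) * cesaro (twist w \<Phi>) m a))"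
proof -
  define M where "M n = cesaro (twist w \<Phi>) n a" for n
  \<comment> \<open>The filter of large n restricted to those with a large mean; proper by the assumption.\<close>
  define F where "F = inf sequentially (principal {n. \<epsilon> \<le> norm (M n)})"
  have F: "F \<noteq> bot"
    using freq unfolding F_def M_def trivial_limit_def eventually_inf_principal frequently_def by simp
  have F_le: "F \<le> sequentially" by (simp add: F_def)
  have F_S: "\<forall>\<^sub>F n in F. \<epsilon> \<le> norm (M n)" by (simp add: F_def eventually_inf_principal)
  note lin = linear_cesaro[OF linear_unital_star_hom[OF hom]]
  define G where "G C x n = cesaro \<Phi> n (x + star x) - C *\<^sub>R (star (M n) * M n - of_real (\<epsilon>\<^sup>2))" for C x n
  define K where "K = {x. \<exists>C\<ge>0. \<forall>\<delta>>0. \<forall>\<^sub>F n in F. positive (G C x n + of_real \<delta>)}"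
  have add: "x + y \<in> K" if "x \<in> K" "y \<in> K" for x y
  proof -
    from that obtain C D where C: "0 \<le> C" "\<And>\<delta>. 0 < \<delta> \<Longrightarrow> \<forall>\<^sub>F n in F. positive (G C x n + of_real \<delta>)"
      and D: "0 \<le> D" "\<And>\<delta>. 0 < \<delta> \<Longrightarrow> \<forall>\<^sub>F n in F. positive (G D y n + of_real \<delta>)"
      unfolding K_def by blast
    have "\<forall>\<^sub>F n in F. positive (G (C + D) (x + y) n + of_real \<delta>)" if "0 < \<delta>" for \<delta>
    proof -
      have "0 < \<delta> / 2" using that by simp
      from C(2)[OF this] D(2)[OF this] show ?thesis
      proof eventually_elim
        case (elim n)
        have "G (C + D) (x + y) n = G C x n + G D y n"
          by (simp add: G_def linear_add[OF lin] star_add algebra_simps)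
        moreover have "of_real \<delta> = of_real (\<delta> / 2) + (of_real (\<delta> / 2) :: 'a)" by (simp flip: of_real_add)
        ultimately show ?case using positive_add[OF elim] by (simp only: ac_simps)
      qed
    qed
    then show ?thesis using C(1) D(1) unfolding K_def by (auto intro!: exI[of _ "C + D"])
  qed
  have in_K: "x \<in> K" if C: "0 \<le> C" and R0: "R \<longlonglongrightarrow> 0" and Rsa: "\<And>n. star (R n) = R n"
    and GR: "\<And>n. positive (G C x n - R n)" for C x R
  proof -
    have "\<forall>\<^sub>F n in F. positive (G C x n + of_real \<delta>)" if \<delta>: "0 < \<delta>" for \<delta>
    proof -
      have "\<forall>\<^sub>F n in sequentially. norm (R n) < \<delta>"
        using R0 \<delta> by (auto simp: tendsto_iff)
      then have "\<forall>\<^sub>F n in sequentially. positive (G C x n + of_real \<delta>)"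
      proof eventually_elim
        case (elim n)
        have "positive (of_real \<delta> + R n)" using Rsa elim by (intro positive_of_real_add) auto
        from positive_add[OF GR[of n] this] show ?case by (simp add: algebra_simps)
      qed
      then show ?thesis by (rule filter_leD[OF F_le])
    qed
    then show ?thesis using C unfolding K_def by blast
  qed
  have pos_in_K: "x \<in> K" if "positive (x + star x)" for x
    by (rule in_K[of 0 "\<lambda>_. 0"]) (use that in \<open>auto simp: G_def intro: positive_cesaro[OF hom]\<close>)
  have scale: "c *\<^sub>R x \<in> K" if "0 \<le> c" "x \<in> K" for c x
  proof (cases "c = 0")
    case False
    with that have c: "0 < c" by simp
    from that obtain C where C: "0 \<le> C" "\<And>\<delta>. 0 < \<delta> \<Longrightarrow> \<forall>\<^sub>F n in F. positive (G C x n + of_real \<delta>)"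
      unfolding K_def by blast
    have "\<forall>\<^sub>F n in F. positive (G (c * C) (c *\<^sub>R x) n + of_real \<delta>)" if "0 < \<delta>" for \<delta>
    proof -
      have "0 < \<delta> / c" using that c by simp
      from C(2)[OF this] show ?thesis
      proof eventually_elim
        case (elim n)
        have "cesaro \<Phi> n (c *\<^sub>R x + star (c *\<^sub>R x)) = c *\<^sub>R cesaro \<Phi> n (x + star x)"
          by (simp add: star_scaleR linear_scale[OF lin] flip: scaleR_add_right)
        then have "G (c * C) (c *\<^sub>R x) n + of_real \<delta> = c *\<^sub>R (G C x n + of_real (\<delta> / c))"
          using c by (simp add: G_def scaleR_add_right scaleR_diff_right) (simp add: of_real_def)
        then show ?case using positive_scaleR[OF elim] c by simp
      qed
    qed
    then show ?thesis using C(1) c unfolding K_def by (auto intro!: exI[of _ "c * C"])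
  qed (auto intro!: pos_in_K)
  have unit: "\<exists>t. t *\<^sub>R 1 - x \<in> K" for x
  proof -
    have "norm (x + star x) \<le> 2 * norm x" using norm_triangle_ineq[of x "star x"] by simp
    then have "positive (of_real (2 * norm x) - (x + star x))"
      by (intro positive_of_real_diff) (simp_all add: star_add star_star add.commute)
    moreover have "norm x *\<^sub>R 1 - x + star (norm x *\<^sub>R 1 - x) = of_real (2 * norm x) - (x + star x)"
      by (simp add: star_diff star_scaleR of_real_def algebra_simps scaleR_2[symmetric])
    ultimately show ?thesis using pos_in_K by metis
  qed
  have one: "1 \<in> K" using positive_of_real_iff[of 2, where ?'a = 'a] by (intro pos_in_K) simp
  have proper: "- 1 \<notin> K"
  proof
    assume "- 1 \<in> K"
    \<comment> \<open>For x = -1 the sum x + x* is -2, so any error below 2 leads to a contradiction.\<close>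
    then obtain C where C: "0 \<le> C" "\<forall>\<^sub>F n in F. positive (G C (- 1) n + of_real 1)"
      unfolding K_def by (auto dest: spec[of _ 1])
    from eventually_happens'[OF F eventually_conj[OF C(2) F_S]]
    obtain n where n: "positive (G C (- 1) n + of_real 1)" "\<epsilon> \<le> norm (M n)" by blast
    have "n \<noteq> 0" using n(2) \<epsilon> by (cases "n = 0") (auto simp: M_def cesaro_def)
    have "- 1 + star (- 1) = (- 2) *\<^sub>R (1 :: 'a)" by (simp add: scaleR_2)
    then have "cesaro \<Phi> n (- 1 + star (- 1)) = (- 2) *\<^sub>R 1"
      using cesaro_one[OF hom, of n] \<open>n \<noteq> 0\<close> by (simp only: linear_scale[OF lin])
    then have "G C (- 1) n + of_real 1 = (- 2) *\<^sub>R 1 - C *\<^sub>R (star (M n) * M n - \<epsilon>\<^sup>2 *\<^sub>R 1) + 1 *\<^sub>R 1"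
      by (simp only: G_def of_real_def)
    also have "\<dots> = (- 2 + C * \<epsilon>\<^sup>2 + 1) *\<^sub>R 1 - C *\<^sub>R (star (M n) * M n)"
      by (simp only: scaleR_diff_right scaleR_add_left scaleR_scaleR) (simp only: algebra_simps)
    finally have "G C (- 1) n + of_real 1 = of_real (C * \<epsilon>\<^sup>2 - 1) - C *\<^sub>R (star (M n) * M n)"
      by (simp add: of_real_def)
    then have "norm (C *\<^sub>R (star (M n) * M n)) \<le> C * \<epsilon>\<^sup>2 - 1"
      using n(1) C(1) by (intro norm_le_if_positive_diff positive_scaleR positive_star_mult_self) simp_all
    then have "C * (norm (M n))\<^sup>2 \<le> C * \<epsilon>\<^sup>2 - 1" using C(1) by (simp add: cstar_identity)
    moreover have "C * \<epsilon>\<^sup>2 \<le> C * (norm (M n))\<^sup>2" using n(2) \<epsilon> C(1) by (intro mult_left_mono power_mono) auto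
    ultimately show False by simp
  qed
  obtain f :: "'a \<Rightarrow> real" where f: "linear f" "f 1 = 1" and fK: "\<And>x. x \<in> K \<Longrightarrow> 0 \<le> f x"
    using positive_functional_extension[of K 1, OF add scale unit one proper] by blast
  have f_skew: "f x = 0" if "x + star x = 0" for x
  proof -
    have "- x + star (- x) = - (x + star x)" by simp
    then have "x \<in> K" "- x \<in> K" using that by (auto intro!: pos_in_K simp del: star_minus)
    then show ?thesis using fK[of x] fK[of "- x"] by (simp add: linear_neg[OF f(1)])
  qed
  \<comment> \<open>The complex linear functional with real part f.\<close>
  define \<phi> where "\<phi> x = Complex (f x) (- f (\<i> *\<^sub>C x))" for x
  have sq: "\<phi> (star x * x) = of_real (f (star x * x))" for x
  proof -
    have "f (\<i> *\<^sub>C (star x * x)) = 0" by (rule f_skew) (simp add: star_scaleC star_mult star_star)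
    then show ?thesis by (simp add: \<phi>_def complex_eq_iff)
  qed
  have "\<phi> \<in> states"
    unfolding states_def mem_Collect_eq
  proof (intro conjI allI)
    show "\<phi> (x + y) = \<phi> x + \<phi> y" for x y
      by (simp add: \<phi>_def scaleC_add_right linear_add[OF f(1)] complex_eq_iff)
    show "\<phi> (c *\<^sub>C x) = c * \<phi> x" for c x
    proof -
      have split: "c *\<^sub>C y = Re c *\<^sub>R y + Im c *\<^sub>R (\<i> *\<^sub>C y)" for y :: 'a
        unfolding scaleR_scaleC scaleC_scaleC scaleC_add_left[symmetric]
        using arg_cong[OF complex_eq[of c], of "\<lambda>d. d *\<^sub>C y"] by (simp add: mult.commute)
      have "\<i> *\<^sub>C (c *\<^sub>C x) = c *\<^sub>C (\<i> *\<^sub>C x)" by (simp add: scaleC_scaleC mult.commute)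
      also have "\<dots> = Re c *\<^sub>R (\<i> *\<^sub>C x) - Im c *\<^sub>R x"
        by (subst split) (simp add: scaleC_scaleC scaleC_one)
      finally show ?thesis
        by (simp add: \<phi>_def split[of x] linear_add[OF f(1)] linear_diff[OF f(1)] linear_scale[OF f(1)]
            complex_eq_iff)
    qed
    show "\<phi> (star x * x) \<in> \<real>\<^sub>\<ge>\<^sub>0" for x
    proof -
      have "positive (star x * x + star (star x * x))"
        by (auto simp: star_mult star_star intro!: positive_add positive_star_mult_self)
      then show ?thesis using fK[OF pos_in_K] by (simp add: sq)
    qed
    have "f (\<i> *\<^sub>C 1) = 0" by (rule f_skew) (simp add: star_scaleC)
    then show "\<phi> 1 = 1" by (simp add: \<phi>_def f complex_eq_iff)
  qed
  moreover have f_inv: "f (\<Phi> x) = f x" for x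
  proof -
    have "s *\<^sub>R (\<Phi> x - x) \<in> K" for s
    proof (rule in_K)
      define h where "h = s *\<^sub>R (x + star x)"
      have sh: "star h = h" by (simp add: h_def star_scaleR star_add star_star add.commute)
      show "(\<lambda>n. cesaro \<Phi> n (\<Phi> h) - cesaro \<Phi> n h) \<longlonglongrightarrow> 0"
        by (rule cesaro_shift_tendsto[OF linear_unital_star_hom[OF hom] norm_unital_star_hom_le[OF hom]])
      have sc: "star (cesaro \<Phi> n g) = cesaro \<Phi> n g" if "star g = g" for n g
        using that
        by (simp add: cesaro_def star_scaleR star_sum flip: unital_star_homD(4)[OF unital_star_hom_funpow[OF hom]])
      have "star (\<Phi> h) = \<Phi> h" using sh by (simp flip: unital_star_homD(4)[OF hom])
      then show "star (cesaro \<Phi> n (\<Phi> h) - cesaro \<Phi> n h) = cesaro \<Phi> n (\<Phi> h) - cesaro \<Phi> n h" for n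
        by (simp add: star_diff sc sh)
      have "s *\<^sub>R (\<Phi> x - x) + star (s *\<^sub>R (\<Phi> x - x)) = \<Phi> h - h"
        by (simp add: h_def star_scaleR star_diff unital_star_homD[OF hom] algebra_simps
            linear_scale[OF linear_unital_star_hom[OF hom]])
      then show "positive (G 0 (s *\<^sub>R (\<Phi> x - x)) n - (cesaro \<Phi> n (\<Phi> h) - cesaro \<Phi> n h))" for n
        by (simp add: G_def linear_diff[OF lin])
    qed simp
    from fK[OF this[of 1]] fK[OF this[of "- 1"]] show ?thesis
      by (simp add: linear_diff[OF f(1)] linear_neg[OF f(1)])
  qed
  have "\<phi> \<circ> \<Phi> = \<phi>"
    using f_inv[of "\<i> *\<^sub>C _"] by (auto simp: \<phi>_def f_inv unital_star_homD[OF hom])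
  ultimately have inv: "\<phi> \<in> invariant_states \<Phi>" by (simp add: invariant_states_def)
  have "\<epsilon>\<^sup>2 \<le> Re (\<phi> (star (M m) * M m))" if "0 < m" for m
  proof -
    have "star (M m) * M m - of_real (\<epsilon>\<^sup>2) \<in> K"
    proof (rule in_K)
      define B where "B n = cesaro (twist w \<Phi>) n (M m)" for n
      \<comment> \<open>Twice, because x + x* = 2 x for self-adjoint x.\<close>
      define R where "R n = 2 *\<^sub>R (star (B n) * B n - star (M n) * M n)" for n
      have BM: "(\<lambda>n. B n - M n) \<longlonglongrightarrow> 0"
        unfolding B_def M_def by (rule cesaro_cesaro_tendsto[OF linear_twist norm_twist_le that])
      have R_le: "norm (R n) \<le> 4 * norm a * norm (B n - M n)" for n
      proof -
        have nM: "norm (M k) \<le> norm a" for k unfolding M_def by (rule norm_cesaro_le[OF norm_twist_le])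
        have nB: "norm (B n) \<le> norm a"
          unfolding B_def by (rule order_trans[OF norm_cesaro_le[OF norm_twist_le] nM])
        have "star (B n) * B n - star (M n) * M n = star (B n) * (B n - M n) + star (B n - M n) * M n"
          by (simp add: star_diff algebra_simps)
        also have "norm \<dots> \<le> norm a * norm (B n - M n) + norm (B n - M n) * norm a"
          using nM nB by (intro norm_triangle_mono order_trans[OF norm_mult_ineq] mult_mono) auto
        finally show ?thesis by (simp add: R_def)
      qed
      show "R \<longlonglongrightarrow> 0"
      proof (rule Lim_null_comparison)
        show "\<forall>\<^sub>F n in sequentially. norm (R n) \<le> 4 * norm a * norm (B n - M n)" using R_le by simp
        show "(\<lambda>n. 4 * norm a * norm (B n - M n)) \<longlonglongrightarrow> 0"
          by (rule tendsto_mult_right_zero[OF tendsto_norm_zero[OF BM]])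
      qed
      show "star (R n) = R n" for n by (simp add: R_def star_scaleR star_diff star_mult star_star)
      have "G 2 (star (M m) * M m - of_real (\<epsilon>\<^sup>2)) n - R n
          = 2 *\<^sub>R (cesaro \<Phi> n (star (M m) * M m) - star (B n) * B n)
            + 2 *\<^sub>R (of_real (\<epsilon>\<^sup>2) - cesaro \<Phi> n (of_real (\<epsilon>\<^sup>2)))" for n
      proof -
        have "star (M m) * M m - of_real (\<epsilon>\<^sup>2) + star (star (M m) * M m - of_real (\<epsilon>\<^sup>2))
            = 2 *\<^sub>R (star (M m) * M m - of_real (\<epsilon>\<^sup>2))"
          by (simp add: star_diff star_mult star_star scaleR_2 del: of_real_power)
        then show ?thesis
          by (simp add: G_def R_def linear_scale[OF lin] linear_diff[OF lin] scaleR_diff_right)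
      qed
      moreover have "positive (of_real (\<epsilon>\<^sup>2) - cesaro \<Phi> n (of_real (\<epsilon>\<^sup>2)) :: 'a)" for n
      proof (cases "n = 0")
        case True
        then show ?thesis using positive_of_real_iff[of "\<epsilon>\<^sup>2"] by (simp add: cesaro_def del: of_real_power)
      next
        case False
        then show ?thesis using cesaro_one[OF hom, of n] by (simp add: of_real_def linear_scale[OF lin] del: of_real_power)
      qed
      moreover have "positive (cesaro \<Phi> n (star (M m) * M m) - star (B n) * B n)" for n
        unfolding B_def by (rule positive_cesaro_variance)
      ultimately show "positive (G 2 (star (M m) * M m - of_real (\<epsilon>\<^sup>2)) n - R n)" for n
        by (auto intro!: positive_add positive_scaleR)
    qed simp
    from fK[OF this] have "f (\<epsilon>\<^sup>2 *\<^sub>R 1) \<le> f (star (M m) * M m)"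
      by (simp add: linear_diff[OF f(1)] of_real_def del: of_real_power)
    then show ?thesis by (simp add: sq linear_scale[OF f(1)] f(2))
  qed
  then show thesis using that[OF inv] by (simp add: M_def)
qed

end

section \<open>The GNS seminorm of a state\<close>

context
  fixes \<phi> :: "'a::cstar_algebra \<Rightarrow> complex"
  assumes state: "\<phi> \<in> states"
begin

lemma state_add: "\<phi> (x + y) = \<phi> x + \<phi> y"
  and state_scaleC: "\<phi> (c *\<^sub>C x) = c * \<phi> x"
  and state_star_mult_self: "\<phi> (star x * x) \<in> \<real>\<^sub>\<ge>\<^sub>0"
  and state_one: "\<phi> 1 = 1"
  using state unfolding states_def by blast+

lemma state_zero: "\<phi> 0 = 0"
  using state_add[of 0 0] by simp

lemma state_minus: "\<phi> (- x) = - \<phi> x"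
  using state_add[of x "- x"] by (simp add: state_zero eq_neg_iff_add_eq_0 add.commute)

lemma state_diff: "\<phi> (x - y) = \<phi> x - \<phi> y"
  using state_add[of x "- y"] by (simp add: state_minus)

lemma state_star_mult_self_eq: "\<phi> (star x * x) = of_real ((gns_seminorm \<phi> x)\<^sup>2)"
  using state_star_mult_self[of x] unfolding gns_seminorm_def by (auto elim!: nonneg_Reals_cases simp flip: of_real_power)

lemma gns_seminorm_nonneg: "0 \<le> gns_seminorm \<phi> x"
  using state_star_mult_self[of x] unfolding gns_seminorm_def by (auto elim!: nonneg_Reals_cases)

lemma gns_seminorm_scaleC: "gns_seminorm \<phi> (c *\<^sub>C x) = cmod c * gns_seminorm \<phi> x"
proof -
  have "\<phi> (star (c *\<^sub>C x) * (c *\<^sub>C x)) = of_real ((cmod c)\<^sup>2) * \<phi> (star x * x)"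
    by (simp add: star_scaleC mult_scaleC_left mult_scaleC_right scaleC_scaleC state_scaleC complex_norm_square mult.commute
        del: of_real_power)
  then have "(gns_seminorm \<phi> (c *\<^sub>C x))\<^sup>2 = (cmod c * gns_seminorm \<phi> x)\<^sup>2"
    unfolding state_star_mult_self_eq by (simp add: power_mult_distrib flip: of_real_power of_real_mult)
  then show ?thesis by (simp add: gns_seminorm_nonneg)
qed

lemma gns_seminorm_minus: "gns_seminorm \<phi> (- x) = gns_seminorm \<phi> x"
  by (simp add: gns_seminorm_def)

lemma gns_seminorm_zero: "gns_seminorm \<phi> 0 = 0"
  by (simp add: gns_seminorm_def state_zero)

lemma gns_seminorm_minus_commute: "gns_seminorm \<phi> (x - y) = gns_seminorm \<phi> (y - x)"
  using gns_seminorm_minus[of "x - y"] by simp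

text \<open>
  Polarization: $\varphi(x^* v) + \varphi(v^* x)$ is real for all $v$, in particular for $v = y$ and $v = i y$.
\<close>

lemma state_hermitian: "\<phi> (star y * x) = cnj (\<phi> (star x * y))"
proof -
  have cross: "\<phi> (star x * v) + \<phi> (star v * x) \<in> \<real>" for v
  proof -
    have "\<phi> (star x * v) + \<phi> (star v * x) = \<phi> (star (x + v) * (x + v)) - \<phi> (star x * x) - \<phi> (star v * v)"
      by (simp add: star_add algebra_simps state_add)
    then show ?thesis by (simp only: state_star_mult_self_eq) simp
  qed
  have "\<phi> (star x * (\<i> *\<^sub>C y)) + \<phi> (star (\<i> *\<^sub>C y) * x) = \<i> * (\<phi> (star x * y) - \<phi> (star y * x))"
    by (simp add: star_scaleC mult_scaleC_left mult_scaleC_right state_scaleC state_minus algebra_simps)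
  then show ?thesis using cross[of y] cross[of "\<i> *\<^sub>C y"] by (simp add: complex_is_Real_iff complex_eq_iff)
qed

lemma gns_seminorm_add_square:
  "(gns_seminorm \<phi> (x + y))\<^sup>2 = (gns_seminorm \<phi> x)\<^sup>2 + (gns_seminorm \<phi> y)\<^sup>2 + 2 * Re (\<phi> (star x * y))"
proof -
  have "of_real ((gns_seminorm \<phi> (x + y))\<^sup>2) = \<phi> (star x * x) + \<phi> (star y * y) + (\<phi> (star x * y) + cnj (\<phi> (star x * y)))"
    unfolding state_star_mult_self_eq[symmetric] state_hermitian[of y x, symmetric]
    by (simp add: star_add algebra_simps state_add)
  then show ?thesis unfolding state_star_mult_self_eq complex_add_cnj by (simp only: of_real_add[symmetric] of_real_eq_iff)
qed

text \<open>
  Expanding $\|s x - t y\|^2 \ge 0$ gives a quadratic form in $s, t$. Evaluating it at $s = q + e$, $t = p + e$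
  with the seminorms $p, q$ of $x, y$ and letting $e$ tend to $0$ also covers vectors of seminorm $0$.
\<close>

lemma Re_state_Cauchy_Schwarz: "Re (\<phi> (star x * y)) \<le> gns_seminorm \<phi> x * gns_seminorm \<phi> y"
proof -
  define p q \<beta> where "p = gns_seminorm \<phi> x" and "q = gns_seminorm \<phi> y" and "\<beta> = Re (\<phi> (star x * y))"
  have p: "0 \<le> p" "0 \<le> q" by (simp_all add: p_def q_def gns_seminorm_nonneg)
  have quad: "2 * s * t * \<beta> \<le> s\<^sup>2 * p\<^sup>2 + t\<^sup>2 * q\<^sup>2" for s t :: real
  proof -
    have "0 \<le> (gns_seminorm \<phi> (of_real s *\<^sub>C x + of_real (- t) *\<^sub>C y))\<^sup>2" by simp
    also have "\<dots> = s\<^sup>2 * p\<^sup>2 + t\<^sup>2 * q\<^sup>2 - 2 * s * t * \<beta>"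
      unfolding gns_seminorm_add_square
      by (simp add: gns_seminorm_scaleC star_scaleC mult_scaleC_left mult_scaleC_right state_scaleC
          state_minus gns_seminorm_minus power_mult_distrib p_def q_def \<beta>_def)
    finally show ?thesis by simp
  qed
  have "\<beta> \<le> (p + e) * (q + e)" if e: "0 < e" for e
  proof -
    have "2 * (q + e) * (p + e) * \<beta> \<le> (q + e)\<^sup>2 * p\<^sup>2 + (p + e)\<^sup>2 * q\<^sup>2" by (rule quad)
    also have "\<dots> \<le> (q + e)\<^sup>2 * (p + e)\<^sup>2 + (p + e)\<^sup>2 * (q + e)\<^sup>2"
      using p e by (intro add_mono mult_left_mono power_mono) auto
    also have "\<dots> = 2 * (q + e) * (p + e) * ((p + e) * (q + e))" by (simp add: power2_eq_square)
    finally show ?thesis using p e by (simp add: mult_le_cancel_left)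
  qed
  then have "\<forall>\<^sub>F e in at_right 0. \<beta> \<le> (p + e) * (q + e)"
    by (intro eventually_at_right_less[THEN eventually_mono]) auto
  moreover have "((\<lambda>e. (p + e) * (q + e)) \<longlongrightarrow> (p + 0) * (q + 0)) (at_right 0)" by (intro tendsto_intros)
  ultimately have "\<beta> \<le> p * q"
    using tendsto_lowerbound[OF _ _ trivial_limit_at_right_real] by fastforce
  then show ?thesis by (simp add: p_def q_def \<beta>_def)
qed

lemma state_Cauchy_Schwarz: "cmod (\<phi> (star x * y)) \<le> gns_seminorm \<phi> x * gns_seminorm \<phi> y"
proof (cases "\<phi> (star x * y) = 0")
  case False
  define u where "u = cnj (sgn (\<phi> (star x * y)))"
  have u: "cmod u = 1" using False by (simp add: u_def norm_sgn)
  have "u * \<phi> (star x * y) = of_real (cmod (\<phi> (star x * y)))"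
    using False by (simp add: u_def sgn_div_norm scaleR_conv_of_real field_simps complex_norm_square[symmetric] power2_eq_square)
  then show ?thesis
    using Re_state_Cauchy_Schwarz[of x "u *\<^sub>C y"] u by (simp add: mult_scaleC_right state_scaleC gns_seminorm_scaleC)
qed (simp add: gns_seminorm_nonneg)

lemma gns_seminorm_triangle: "gns_seminorm \<phi> (x + y) \<le> gns_seminorm \<phi> x + gns_seminorm \<phi> y"
proof (rule power2_le_imp_le)
  show "(gns_seminorm \<phi> (x + y))\<^sup>2 \<le> (gns_seminorm \<phi> x + gns_seminorm \<phi> y)\<^sup>2"
    using Re_state_Cauchy_Schwarz[of x y] by (simp add: gns_seminorm_add_square power2_sum)
qed (simp add: gns_seminorm_nonneg)

lemma gns_seminorm_triangle_diff: "gns_seminorm \<phi> (x - z) \<le> gns_seminorm \<phi> (x - y) + gns_seminorm \<phi> (y - z)"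
  using gns_seminorm_triangle[of "x - y" "y - z"] by simp

lemma gns_seminorm_parallelogram:
  "(gns_seminorm \<phi> (x - y))\<^sup>2 + (gns_seminorm \<phi> (x + y))\<^sup>2 = 2 * (gns_seminorm \<phi> x)\<^sup>2 + 2 * (gns_seminorm \<phi> y)\<^sup>2"
  using gns_seminorm_add_square[of x y] gns_seminorm_add_square[of x "- y"] by (simp add: gns_seminorm_minus state_minus)

lemma gns_seminorm_reverse_triangle: "\<bar>gns_seminorm \<phi> x - gns_seminorm \<phi> y\<bar> \<le> gns_seminorm \<phi> (x - y)"
  using gns_seminorm_triangle[of "x - y" y] gns_seminorm_triangle[of "y - x" x] gns_seminorm_minus_commute[of x y] by simp

text \<open>
  With $\|b\|^2 - b^* b = r^2$ for a self-adjoint $r$, the nonnegative number $\varphi((r x)^* (r x))$ equals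
  $\|b\|^2 \varphi(x^* x) - \varphi((b x)^* (b x))$.
\<close>

lemma gns_seminorm_mult_le: "gns_seminorm \<phi> (b * x) \<le> norm b * gns_seminorm \<phi> x"
proof (rule power2_le_imp_le)
  have "positive (of_real ((norm b)\<^sup>2) - star b * b)"
    by (rule positive_of_real_diff) (simp_all add: star_mult star_star cstar_identity)
  then obtain r where r: "positive r" "r * r = of_real ((norm b)\<^sup>2) - star b * b"
    using positive_square_root by metis
  have "star (r * x) * (r * x) = star x * (r * r) * x"
    by (simp add: star_mult positive_star[OF r(1)] mult.assoc)
  also have "\<dots> = of_real ((norm b)\<^sup>2) *\<^sub>C (star x * x) - star (b * x) * (b * x)"
    unfolding r(2) scaleR_scaleC[symmetric] by (simp add: star_mult algebra_simps of_real_def del: of_real_power)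
  finally have "of_real ((gns_seminorm \<phi> (r * x))\<^sup>2)
      = of_real ((norm b)\<^sup>2) * of_real ((gns_seminorm \<phi> x)\<^sup>2) - complex_of_real ((gns_seminorm \<phi> (b * x))\<^sup>2)"
    unfolding state_star_mult_self_eq[symmetric] by (simp add: state_diff state_scaleC)
  then have "(gns_seminorm \<phi> (r * x))\<^sup>2 = (norm b)\<^sup>2 * (gns_seminorm \<phi> x)\<^sup>2 - (gns_seminorm \<phi> (b * x))\<^sup>2"
    by (simp only: of_real_eq_iff flip: of_real_mult of_real_diff)
  then show "(gns_seminorm \<phi> (b * x))\<^sup>2 \<le> (norm b * gns_seminorm \<phi> x)\<^sup>2"
    using zero_le_power2[of "gns_seminorm \<phi> (r * x)"] by (simp add: power_mult_distrib)
qed (simp add: gns_seminorm_nonneg)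

lemma gns_seminorm_one: "gns_seminorm \<phi> 1 = 1"
  by (simp add: gns_seminorm_def state_one)

lemma gns_seminorm_le_norm: "gns_seminorm \<phi> x \<le> norm x"
  using gns_seminorm_mult_le[of x 1] by (simp add: gns_seminorm_one)

lemma gns_seminorm_null_comparison:
  assumes "\<And>n. gns_seminorm \<phi> (X n) \<le> g n" "g \<longlonglongrightarrow> 0"
  shows "(\<lambda>n. gns_seminorm \<phi> (X n)) \<longlonglongrightarrow> 0"
  by (rule Lim_null_comparison[OF _ assms(2)]) (simp add: gns_seminorm_nonneg assms(1))

lemma gns_seminorm_tendsto_0: "X \<longlonglongrightarrow> 0 \<Longrightarrow> (\<lambda>n. gns_seminorm \<phi> (X n)) \<longlonglongrightarrow> 0"
  by (rule gns_seminorm_null_comparison[OF gns_seminorm_le_norm tendsto_norm_zero])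

lemma gns_Cauchy_const: "(\<lambda>n. x) \<in> gns_Cauchy \<phi>"
  by (simp add: gns_Cauchy_def gns_seminorm_zero)

lemma gns_CauchyD:
  assumes "X \<in> gns_Cauchy \<phi>" "0 < e"
  obtains N where "\<And>m n. N \<le> m \<Longrightarrow> N \<le> n \<Longrightarrow> gns_seminorm \<phi> (X m - X n) < e"
proof -
  have "\<exists>N. \<forall>m\<ge>N. \<forall>n\<ge>N. gns_seminorm \<phi> (X m - X n) < e"
    using assms by (simp add: gns_Cauchy_def)
  then show thesis using that by blast
qed

lemma equiv_gns_rel: "equiv (gns_Cauchy \<phi>) (gns_rel \<phi>)"
proof (rule equivI)
  show "gns_rel \<phi> \<subseteq> gns_Cauchy \<phi> \<times> gns_Cauchy \<phi>" by (auto simp: gns_rel_def)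
  show "refl_on (gns_Cauchy \<phi>) (gns_rel \<phi>)"
    by (auto simp: refl_on_def gns_rel_def gns_seminorm_zero)
  show "sym (gns_rel \<phi>)"
    by (auto simp: sym_def gns_rel_def) (subst gns_seminorm_minus_commute, assumption)
  show "trans (gns_rel \<phi>)"
  proof (rule transI)
    fix X Y Z assume XY: "(X, Y) \<in> gns_rel \<phi>" and YZ: "(Y, Z) \<in> gns_rel \<phi>"
    have "(\<lambda>n. gns_seminorm \<phi> (X n - Y n) + gns_seminorm \<phi> (Y n - Z n)) \<longlonglongrightarrow> 0"
      using XY YZ by (auto simp: gns_rel_def intro: tendsto_add_zero)
    then have "(\<lambda>n. gns_seminorm \<phi> (X n - Z n)) \<longlonglongrightarrow> 0"
      by (rule gns_seminorm_null_comparison[OF gns_seminorm_triangle_diff])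
    then show "(X, Z) \<in> gns_rel \<phi>" using XY YZ by (auto simp: gns_rel_def)
  qed
qed

lemma gns_class_eq_iff:
  assumes "X \<in> gns_Cauchy \<phi>" "Y \<in> gns_Cauchy \<phi>"
  shows "gns_class \<phi> X = gns_class \<phi> Y \<longleftrightarrow> (\<lambda>n. gns_seminorm \<phi> (X n - Y n)) \<longlonglongrightarrow> 0"
  unfolding gns_class_def eq_equiv_class_iff[OF equiv_gns_rel assms] using assms by (simp add: gns_rel_def)

lemma mem_gns_class:
  "Y \<in> gns_class \<phi> X \<longleftrightarrow> X \<in> gns_Cauchy \<phi> \<and> Y \<in> gns_Cauchy \<phi> \<and> (\<lambda>n. gns_seminorm \<phi> (X n - Y n)) \<longlonglongrightarrow> 0"
  by (auto simp: gns_class_def gns_rel_def)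

lemma gns_class_self: "X \<in> gns_Cauchy \<phi> \<Longrightarrow> X \<in> gns_class \<phi> X"
  by (simp add: mem_gns_class gns_seminorm_zero)

lemma gns_class_in_space: "X \<in> gns_Cauchy \<phi> \<Longrightarrow> gns_class \<phi> X \<in> gns_space \<phi>"
  unfolding gns_class_def gns_space_def by (rule quotientI)

lemma gns_spaceE:
  assumes "P \<in> gns_space \<phi>"
  obtains X where "X \<in> gns_Cauchy \<phi>" "P = gns_class \<phi> X"
  using assms unfolding gns_space_def gns_class_def by (auto elim: quotientE)

lemma gns_Cauchy_lipschitz:
  assumes T: "\<And>x y. gns_seminorm \<phi> (T x - T y) \<le> c * gns_seminorm \<phi> (x - y)" and X: "X \<in> gns_Cauchy \<phi>"
  shows "(\<lambda>n. T (X n)) \<in> gns_Cauchy \<phi>"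
  unfolding gns_Cauchy_def
proof (intro CollectI allI impI)
  fix e :: real assume e: "0 < e"
  then have "0 < e / (\<bar>c\<bar> + 1)" by simp
  then obtain N where N: "\<And>m n. N \<le> m \<Longrightarrow> N \<le> n \<Longrightarrow> gns_seminorm \<phi> (X m - X n) < e / (\<bar>c\<bar> + 1)"
    using gns_CauchyD[OF X] by blast
  have "gns_seminorm \<phi> (T (X m) - T (X n)) < e" if "N \<le> m" "N \<le> n" for m n
  proof -
    have "gns_seminorm \<phi> (T (X m) - T (X n)) \<le> (\<bar>c\<bar> + 1) * gns_seminorm \<phi> (X m - X n)"
      using T by (rule order_trans) (simp add: mult_right_mono gns_seminorm_nonneg)
    also have "\<dots> < e" using N[OF that] by (simp add: field_simps)
    finally show ?thesis .
  qed
  then show "\<exists>N. \<forall>m\<ge>N. \<forall>n\<ge>N. gns_seminorm \<phi> (T (X m) - T (X n)) < e" by blast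
qed

text \<open>
  The common reason why scalar multiplication, left multiplication and the isometry, each given by a union over
  representatives, are computed on any one representative.
\<close>

lemma gns_class_lipschitz:
  assumes T: "\<And>x y. gns_seminorm \<phi> (T x - T y) \<le> c * gns_seminorm \<phi> (x - y)" and X: "X \<in> gns_Cauchy \<phi>"
  shows "(\<Union>Y\<in>gns_class \<phi> X. gns_class \<phi> (\<lambda>n. T (Y n))) = gns_class \<phi> (\<lambda>n. T (X n))"
proof -
  have "gns_class \<phi> (\<lambda>n. T (Y n)) = gns_class \<phi> (\<lambda>n. T (X n))" if Y: "Y \<in> gns_class \<phi> X" for Y
  proof -
    have "(\<lambda>n. gns_seminorm \<phi> (X n - Y n)) \<longlonglongrightarrow> 0" "Y \<in> gns_Cauchy \<phi>" using Y by (auto simp: mem_gns_class)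
    moreover from this have "(\<lambda>n. gns_seminorm \<phi> (T (X n) - T (Y n))) \<longlonglongrightarrow> 0"
      by (intro gns_seminorm_null_comparison[OF T] tendsto_mult_right_zero)
    ultimately have "gns_class \<phi> (\<lambda>n. T (X n)) = gns_class \<phi> (\<lambda>n. T (Y n))"
      using X by (subst gns_class_eq_iff) (auto intro: gns_Cauchy_lipschitz[OF T])
    then show ?thesis by simp
  qed
  then show ?thesis using gns_class_self[OF X] by blast
qed

lemma gns_scale_class:
  assumes "X \<in> gns_Cauchy \<phi>"
  shows "gns_scale \<phi> c (gns_class \<phi> X) = gns_class \<phi> (\<lambda>n. c *\<^sub>C X n)" "(\<lambda>n. c *\<^sub>C X n) \<in> gns_Cauchy \<phi>"
  unfolding gns_scale_def using gns_class_lipschitz[OF _ assms, of "\<lambda>x. c *\<^sub>C x" "cmod c"]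
    gns_Cauchy_lipschitz[OF _ assms, of "\<lambda>x. c *\<^sub>C x" "cmod c"]
  by (simp_all add: gns_seminorm_scaleC flip: scaleC_diff_right)

lemma gns_rep_vector: "gns_rep \<phi> b (gns_vector \<phi>) = gns_class \<phi> (\<lambda>n. b)"
  unfolding gns_rep_def gns_vector_def
  using gns_class_lipschitz[OF _ gns_Cauchy_const, of "\<lambda>x. b * x" "norm b" 1]
  by (simp add: gns_seminorm_mult_le flip: right_diff_distrib)

lemma gns_Cauchy_add:
  assumes X: "X \<in> gns_Cauchy \<phi>" and Y: "Y \<in> gns_Cauchy \<phi>"
  shows "(\<lambda>n. X n + Y n) \<in> gns_Cauchy \<phi>"
  unfolding gns_Cauchy_def
proof (intro CollectI allI impI)
  fix e :: real assume "0 < e"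
  then have "0 < e / 2" by simp
  obtain N where N: "\<And>m n. N \<le> m \<Longrightarrow> N \<le> n \<Longrightarrow> gns_seminorm \<phi> (X m - X n) < e / 2"
    using gns_CauchyD[OF X \<open>0 < e / 2\<close>] by blast
  obtain N' where N': "\<And>m n. N' \<le> m \<Longrightarrow> N' \<le> n \<Longrightarrow> gns_seminorm \<phi> (Y m - Y n) < e / 2"
    using gns_CauchyD[OF Y \<open>0 < e / 2\<close>] by blast
  have "gns_seminorm \<phi> (X m + Y m - (X n + Y n)) < e" if "max N N' \<le> m" "max N N' \<le> n" for m n
    using N[of m n] N'[of m n] that gns_seminorm_triangle[of "X m - X n" "Y m - Y n"]
    by (simp add: algebra_simps)
  then show "\<exists>N. \<forall>m\<ge>N. \<forall>n\<ge>N. gns_seminorm \<phi> (X m + Y m - (X n + Y n)) < e" by blast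
qed

lemma gns_add_class:
  assumes X: "X \<in> gns_Cauchy \<phi>" and Y: "Y \<in> gns_Cauchy \<phi>"
  shows "gns_add \<phi> (gns_class \<phi> X) (gns_class \<phi> Y) = gns_class \<phi> (\<lambda>n. X n + Y n)"
proof -
  have "gns_class \<phi> (\<lambda>n. X' n + Y' n) = gns_class \<phi> (\<lambda>n. X n + Y n)"
    if X': "X' \<in> gns_class \<phi> X" and Y': "Y' \<in> gns_class \<phi> Y" for X' Y'
  proof -
    have "(\<lambda>n. gns_seminorm \<phi> (X n - X' n) + gns_seminorm \<phi> (Y n - Y' n)) \<longlonglongrightarrow> 0"
      using X' Y' by (auto simp: mem_gns_class intro: tendsto_add_zero)
    moreover have "gns_seminorm \<phi> (X n + Y n - (X' n + Y' n)) \<le> gns_seminorm \<phi> (X n - X' n) + gns_seminorm \<phi> (Y n - Y' n)" for n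
      using gns_seminorm_triangle[of "X n - X' n" "Y n - Y' n"] by (simp add: algebra_simps)
    ultimately have "(\<lambda>n. gns_seminorm \<phi> (X n + Y n - (X' n + Y' n))) \<longlonglongrightarrow> 0"
      by (rule gns_seminorm_null_comparison[rotated])
    then have "gns_class \<phi> (\<lambda>n. X n + Y n) = gns_class \<phi> (\<lambda>n. X' n + Y' n)"
      using X' Y' by (subst gns_class_eq_iff) (auto simp: mem_gns_class intro: gns_Cauchy_add)
    then show ?thesis by simp
  qed
  then show ?thesis using gns_class_self[OF X] gns_class_self[OF Y] unfolding gns_add_def by blast
qed

lemma gns_seminorm_convergent:
  assumes X: "X \<in> gns_Cauchy \<phi>"
  shows "convergent (\<lambda>n. gns_seminorm \<phi> (X n))"
  unfolding Cauchy_convergent_iff[symmetric]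
proof (rule CauchyI)
  fix e :: real assume "0 < e"
  then obtain N where "\<And>m n. N \<le> m \<Longrightarrow> N \<le> n \<Longrightarrow> gns_seminorm \<phi> (X m - X n) < e"
    using gns_CauchyD[OF X] by blast
  then show "\<exists>N. \<forall>m\<ge>N. \<forall>n\<ge>N. norm (gns_seminorm \<phi> (X m) - gns_seminorm \<phi> (X n)) < e"
    using gns_seminorm_reverse_triangle by (metis le_less_trans real_norm_def)
qed

text \<open>
  By the Cauchy-Schwarz inequality the numbers $\varphi(Y_n^* Z_n)$ have the same limit for all
  representatives $Y, Z$ of a class, so the definite description in the inner product denotes it.
\<close>

lemma gns_norm_class:
  assumes X: "X \<in> gns_Cauchy \<phi>"
  shows "(\<lambda>n. gns_seminorm \<phi> (X n)) \<longlonglongrightarrow> gns_norm \<phi> (gns_class \<phi> X)"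
proof -
  obtain L where L: "(\<lambda>n. gns_seminorm \<phi> (X n)) \<longlonglongrightarrow> L"
    using gns_seminorm_convergent[OF X] by (auto simp: convergent_def)
  have L0: "0 \<le> L" using L gns_seminorm_nonneg by (intro LIMSEQ_le_const) auto
  have lim: "(\<lambda>n. \<phi> (star (Y n) * Z n)) \<longlonglongrightarrow> of_real (L\<^sup>2)"
    if Y: "Y \<in> gns_class \<phi> X" and Z: "Z \<in> gns_class \<phi> X" for Y Z
  proof -
    have XX: "(\<lambda>n. \<phi> (star (X n) * X n)) \<longlonglongrightarrow> of_real (L\<^sup>2)"
      unfolding state_star_mult_self_eq by (intro tendsto_of_real tendsto_power L)
    obtain l where l: "(\<lambda>n. gns_seminorm \<phi> (Z n)) \<longlonglongrightarrow> l"
      using gns_seminorm_convergent Z by (auto simp: mem_gns_class convergent_def)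
    have *: "(\<lambda>n. gns_seminorm \<phi> (X n - Y n) * gns_seminorm \<phi> (Z n) + gns_seminorm \<phi> (X n) * gns_seminorm \<phi> (X n - Z n))
        \<longlonglongrightarrow> 0 * l + L * 0"
      using Y Z by (intro tendsto_intros l L) (auto simp: mem_gns_class)
    have "(\<lambda>n. \<phi> (star (Y n) * Z n) - \<phi> (star (X n) * X n)) \<longlonglongrightarrow> 0"
    proof (rule Lim_null_comparison[OF always_eventually])
      show "\<forall>n. norm (\<phi> (star (Y n) * Z n) - \<phi> (star (X n) * X n))
          \<le> gns_seminorm \<phi> (X n - Y n) * gns_seminorm \<phi> (Z n) + gns_seminorm \<phi> (X n) * gns_seminorm \<phi> (X n - Z n)"
      proof
        fix n
        have "\<phi> (star (Y n) * Z n) - \<phi> (star (X n) * X n)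
            = - (\<phi> (star (X n - Y n) * Z n) + \<phi> (star (X n) * (X n - Z n)))"
          by (simp add: star_diff algebra_simps state_diff)
        then have "norm (\<phi> (star (Y n) * Z n) - \<phi> (star (X n) * X n))
            \<le> norm (\<phi> (star (X n - Y n) * Z n)) + norm (\<phi> (star (X n) * (X n - Z n)))"
          by (metis norm_minus_cancel norm_triangle_ineq)
        then show "norm (\<phi> (star (Y n) * Z n) - \<phi> (star (X n) * X n))
          \<le> gns_seminorm \<phi> (X n - Y n) * gns_seminorm \<phi> (Z n) + gns_seminorm \<phi> (X n) * gns_seminorm \<phi> (X n - Z n)"
          using state_Cauchy_Schwarz[of "X n - Y n" "Z n"] state_Cauchy_Schwarz[of "X n" "X n - Z n"] by linarith
      qed
    qed (use * in simp)
    from tendsto_add[OF this XX] show ?thesis by simp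
  qed
  have "gns_inner \<phi> (gns_class \<phi> X) (gns_class \<phi> X) = of_real (L\<^sup>2)"
    unfolding gns_inner_def
  proof (rule the_equality)
    fix c assume "\<forall>Y\<in>gns_class \<phi> X. \<forall>Z\<in>gns_class \<phi> X. (\<lambda>n. \<phi> (star (Y n) * Z n)) \<longlonglongrightarrow> c"
    then show "c = of_real (L\<^sup>2)" using gns_class_self[OF X] lim LIMSEQ_unique by blast
  qed (use lim in blast)
  then show ?thesis using L L0 by (simp add: gns_norm_def)
qed

end

context
  fixes \<phi> :: "'a::cstar_algebra \<Rightarrow> complex" and \<Phi> :: "'a \<Rightarrow> 'a"
  assumes hom: "unital_star_hom \<Phi>" and inv: "\<phi> \<in> invariant_states \<Phi>"
begin

lemma invariant_state: "\<phi> \<in> states"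
  using inv by (simp add: invariant_states_def)

lemma gns_seminorm_hom: "gns_seminorm \<phi> (\<Phi> x) = gns_seminorm \<phi> x"
proof -
  have "\<phi> (\<Phi> y) = \<phi> y" for y using inv unfolding invariant_states_def by (auto dest: fun_cong)
  then show ?thesis by (simp add: gns_seminorm_def flip: unital_star_homD[OF hom])
qed

text \<open>
  Applying $\Phi$ termwise has all the properties that describe the isometry. Conversely, a linear
  isometry $W$ with $W b \xi = \Phi(b) \xi$ agrees with it: a vector $P$ with representative $X$ is approximated by the
  vectors $X_N \xi$, and $W P$ is just as close to $\Phi(X_N) \xi$ as $P$ is to $X_N \xi$.
\<close>

lemma gns_isometry_class:
  assumes X: "X \<in> gns_Cauchy \<phi>"
  shows "gns_isometry \<phi> \<Phi> (gns_class \<phi> X) = gns_class \<phi> (\<lambda>n. \<Phi> (X n))" "(\<lambda>n. \<Phi> (X n)) \<in> gns_Cauchy \<phi>"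
proof -
  note state = invariant_state
  note lin = linear_unital_star_hom[OF hom]
  have lip: "gns_seminorm \<phi> (\<Phi> x - \<Phi> y) \<le> 1 * gns_seminorm \<phi> (x - y)" for x y
    by (simp add: gns_seminorm_hom flip: linear_diff[OF lin])
  note cauchy = gns_Cauchy_lipschitz[OF state, of \<Phi>, OF lip]
  define V where "V = restrict (\<lambda>P. \<Union>Y\<in>P. gns_class \<phi> (\<lambda>n. \<Phi> (Y n))) (gns_space \<phi>)"
  have V: "V (gns_class \<phi> Y) = gns_class \<phi> (\<lambda>n. \<Phi> (Y n))" if "Y \<in> gns_Cauchy \<phi>" for Y
    using gns_class_lipschitz[OF state, of \<Phi>, OF lip that] gns_class_in_space[OF state that] by (simp add: V_def)
  have "gns_isometry \<phi> \<Phi> = V"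
    unfolding gns_isometry_def
  proof (rule the_equality, intro conjI allI)
    show "V \<in> extensional (gns_space \<phi>)" by (simp add: V_def)
    show "V (gns_rep \<phi> b (gns_vector \<phi>)) = gns_rep \<phi> (\<Phi> b) (gns_vector \<phi>)" for b
      by (simp add: gns_rep_vector[OF state] V gns_Cauchy_const[OF state])
    show "gns_linear_isometry \<phi> V"
      unfolding gns_linear_isometry_def
    proof (intro conjI ballI allI)
      show "V \<in> gns_space \<phi> \<rightarrow> gns_space \<phi>"
        by (auto elim!: gns_spaceE[OF state] simp: V gns_class_in_space[OF state] cauchy)
      fix P assume "P \<in> gns_space \<phi>"
      then obtain Y where Y: "Y \<in> gns_Cauchy \<phi>" "P = gns_class \<phi> Y" by (rule gns_spaceE[OF state])
      show "V (gns_scale \<phi> c P) = gns_scale \<phi> c (V P)" for c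
        by (simp add: Y V gns_scale_class[OF state] cauchy unital_star_homD[OF hom])
      show "gns_norm \<phi> (V P) = gns_norm \<phi> P"
        using gns_norm_class[OF state Y(1)] gns_norm_class[OF state cauchy[OF Y(1)]] LIMSEQ_unique
        by (auto simp: Y V gns_seminorm_hom)
      fix Q assume "Q \<in> gns_space \<phi>"
      then obtain Z where Z: "Z \<in> gns_Cauchy \<phi>" "Q = gns_class \<phi> Z" by (rule gns_spaceE[OF state])
      show "V (gns_add \<phi> P Q) = gns_add \<phi> (V P) (V Q)"
        by (simp add: Y Z V gns_add_class[OF state] gns_Cauchy_add[OF state] cauchy unital_star_homD[OF hom])
    qed
  next
    fix W assume "W \<in> extensional (gns_space \<phi>) \<and> gns_linear_isometry \<phi> W \<and>
      (\<forall>b. W (gns_rep \<phi> b (gns_vector \<phi>)) = gns_rep \<phi> (\<Phi> b) (gns_vector \<phi>))"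
    then have ext: "W \<in> extensional (gns_space \<phi>)" and iso: "gns_linear_isometry \<phi> W"
      and const: "\<And>b. W (gns_class \<phi> (\<lambda>n. b)) = gns_class \<phi> (\<lambda>n. \<Phi> b)"
      by (simp_all add: gns_rep_vector[OF state])
    show "W = V"
    proof (rule extensionalityI[OF ext])
      show "V \<in> extensional (gns_space \<phi>)" by (simp add: V_def)
      fix P assume P: "P \<in> gns_space \<phi>"
      then obtain X where X: "X \<in> gns_Cauchy \<phi>" "P = gns_class \<phi> X" by (rule gns_spaceE[OF state])
      have "W P \<in> gns_space \<phi>" using P iso by (auto simp: gns_linear_isometry_def)
      then obtain Y where Y: "Y \<in> gns_Cauchy \<phi>" "W P = gns_class \<phi> Y" by (rule gns_spaceE[OF state])
      have near: "(\<lambda>n. gns_seminorm \<phi> (Y n - \<Phi> b)) \<longlonglongrightarrow> gns_norm \<phi> (gns_class \<phi> (\<lambda>n. X n - b))" for b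
      proof -
        have minus: "(\<lambda>n. Z n - c) \<in> gns_Cauchy \<phi> \<and>
            gns_add \<phi> (gns_class \<phi> Z) (gns_scale \<phi> (- 1) (gns_class \<phi> (\<lambda>n. c))) = gns_class \<phi> (\<lambda>n. Z n - c)"
          if "Z \<in> gns_Cauchy \<phi>" for Z c
          using gns_Cauchy_add[OF state that gns_Cauchy_const[OF state, of "- c"]]
            gns_add_class[OF state that gns_Cauchy_const[OF state, of "- c"]]
          by (simp add: gns_scale_class[OF state gns_Cauchy_const[OF state]] scaleC_one)
        let ?b = "gns_class \<phi> (\<lambda>n. b)"
        have b: "?b \<in> gns_space \<phi>" by (intro gns_class_in_space gns_Cauchy_const state)
        have sb: "gns_scale \<phi> (- 1) ?b \<in> gns_space \<phi>"
          by (simp add: gns_scale_class[OF state gns_Cauchy_const[OF state]] gns_class_in_space[OF state] gns_Cauchy_const[OF state])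
        have "W (gns_class \<phi> (\<lambda>n. X n - b)) = W (gns_add \<phi> P (gns_scale \<phi> (- 1) ?b))"
          using minus[OF X(1)] X(2) by simp
        also have "\<dots> = gns_add \<phi> (W P) (gns_scale \<phi> (- 1) (W ?b))"
          using iso P b sb unfolding gns_linear_isometry_def by metis
        also have "\<dots> = gns_class \<phi> (\<lambda>n. Y n - \<Phi> b)" using minus[OF Y(1)] Y(2) const by simp
        finally have "gns_norm \<phi> (gns_class \<phi> (\<lambda>n. Y n - \<Phi> b)) = gns_norm \<phi> (gns_class \<phi> (\<lambda>n. X n - b))"
          using iso minus[OF X(1)] gns_class_in_space[OF state] unfolding gns_linear_isometry_def by metis
        then show ?thesis using gns_norm_class[OF state, of "\<lambda>n. Y n - \<Phi> b"] minus[OF Y(1)] by simp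
      qed
      have "(\<lambda>n. gns_seminorm \<phi> (Y n - \<Phi> (X n))) \<longlonglongrightarrow> 0"
      proof (rule LIMSEQ_I)
        fix e :: real assume e: "0 < e"
        then have "0 < e / 3" by simp
        then obtain N where N: "\<And>m n. N \<le> m \<Longrightarrow> N \<le> n \<Longrightarrow> gns_seminorm \<phi> (X m - X n) < e / 3"
          using gns_CauchyD[OF state X(1)] by blast
        have XN: "(\<lambda>n. X n - X N) \<in> gns_Cauchy \<phi>"
          using gns_Cauchy_add[OF state X(1) gns_Cauchy_const[OF state, of "- X N"]] by simp
        have "gns_norm \<phi> (gns_class \<phi> (\<lambda>n. X n - X N)) \<le> e / 3"
          using N[of _ N] by (intro LIMSEQ_le_const2[OF gns_norm_class[OF state XN]] exI[of _ N]) (auto intro: less_imp_le)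
        then have "gns_norm \<phi> (gns_class \<phi> (\<lambda>n. X n - X N)) < 2 * e / 3" using e by simp
        then obtain N' where N': "\<And>n. N' \<le> n \<Longrightarrow> gns_seminorm \<phi> (Y n - \<Phi> (X N)) < 2 * e / 3"
          using order_tendstoD(2)[OF near] unfolding eventually_sequentially by blast
        have "norm (gns_seminorm \<phi> (Y n - \<Phi> (X n)) - 0) < e" if n: "max N N' \<le> n" for n
          using gns_seminorm_triangle_diff[OF state, of "Y n" "\<Phi> (X n)" "\<Phi> (X N)"] N'[of n] N[of N n] n lip[of "X N" "X n"]
          by (simp add: gns_seminorm_nonneg[OF state])
        then show "\<exists>N. \<forall>n\<ge>N. norm (gns_seminorm \<phi> (Y n - \<Phi> (X n)) - 0) < e" by blast
      qed
      then show "W P = V P" using Y X V[OF X(1)] gns_class_eq_iff[OF state Y(1) cauchy[OF X(1)]] by simp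
    qed
  qed
  then show "gns_isometry \<phi> \<Phi> (gns_class \<phi> X) = gns_class \<phi> (\<lambda>n. \<Phi> (X n))" "(\<lambda>n. \<Phi> (X n)) \<in> gns_Cauchy \<phi>"
    using V X cauchy by simp_all
qed

end

section \<open>Convergence of ergodic means in the GNS space\<close>

text \<open>
  Von Neumann's mean ergodic theorem for a seminorm. Let $L$ be the infimum of the seminorms of the
  means $M_n$. The means of the midpoint of $M_m$ and $M_n$ are asymptotically the $M_N$, and taking means
  does not increase the seminorm; hence the seminorm of $M_N$ is eventually below any number above that of the midpoint.
  For $m = n$ this shows that the seminorms converge to $L$, and in general that each
  midpoint has seminorm at least $L$. The parallelogram law then makes $M_m - M_n$ small. The norm
  bound on $T$ is what makes iterated means comparable, by the telescoping estimate.
\<close>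

lemma mean_ergodic_gns_Cauchy:
  fixes T :: "'a::cstar_algebra \<Rightarrow> 'a"
  assumes state: "\<phi> \<in> states" and lin: "linear T" and le: "\<And>x. norm (T x) \<le> norm x"
    and contr: "\<And>x. gns_seminorm \<phi> (T x) \<le> gns_seminorm \<phi> x"
  shows "(\<lambda>n. cesaro T n a) \<in> gns_Cauchy \<phi>"
proof -
  define M where "M n = cesaro T n a" for n
  note lc = linear_cesaro[OF lin]
  have s_scale: "gns_seminorm \<phi> (r *\<^sub>R x) = \<bar>r\<bar> * gns_seminorm \<phi> x" for r x
    by (simp add: scaleR_scaleC gns_seminorm_scaleC[OF state])
  have pow: "gns_seminorm \<phi> ((T ^^ k) x) \<le> gns_seminorm \<phi> x" for k x
    by (induction k) (auto intro: order_trans[OF contr])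
  have sum: "gns_seminorm \<phi> (\<Sum>k<n. (T ^^ k) x) \<le> real n * gns_seminorm \<phi> x" for n x
  proof (induction n)
    case (Suc n)
    show ?case
      using gns_seminorm_triangle[OF state, of "\<Sum>k<n. (T ^^ k) x" "(T ^^ n) x"] Suc pow[of n x]
      by (simp add: algebra_simps)
  qed (simp add: gns_seminorm_zero[OF state])
  have ces: "gns_seminorm \<phi> (cesaro T n x) \<le> gns_seminorm \<phi> x" for n x
  proof (cases "n = 0")
    case False
    then show ?thesis using sum[of x n] by (simp add: cesaro_def s_scale field_simps)
  qed (simp add: cesaro_def gns_seminorm_zero[OF state] gns_seminorm_nonneg[OF state])
  define mid where "mid m n = (1/2) *\<^sub>R (M m + M n)" for m n
  have upper: "\<forall>\<^sub>F N in sequentially. gns_seminorm \<phi> (M N) < c"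
    if mn: "0 < m" "0 < n" and c: "gns_seminorm \<phi> (mid m n) < c" for m n c
  proof -
    have "(\<lambda>N. (1/2) *\<^sub>R ((cesaro T N (M m) - M N) + (cesaro T N (M n) - M N))) \<longlonglongrightarrow> (1/2) *\<^sub>R (0 + 0)"
      unfolding M_def by (intro tendsto_intros cesaro_cesaro_tendsto[OF lin le] mn)
    moreover have "(1/2) *\<^sub>R ((cesaro T N (M m) - M N) + (cesaro T N (M n) - M N)) = cesaro T N (mid m n) - M N" for N
      by (simp add: mid_def linear_scale[OF lc] linear_add[OF lc] algebra_simps scaleR_2[symmetric])
    ultimately have "(\<lambda>N. gns_seminorm \<phi> (cesaro T N (mid m n) - M N)) \<longlonglongrightarrow> 0"
      by (intro gns_seminorm_tendsto_0[OF state]) simp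
    then have "\<forall>\<^sub>F N in sequentially. gns_seminorm \<phi> (cesaro T N (mid m n) - M N) < c - gns_seminorm \<phi> (mid m n)"
      by (rule order_tendstoD) (use c in simp)
    then show ?thesis
    proof eventually_elim
      case (elim N)
      then show ?case
        using gns_seminorm_reverse_triangle[OF state, of "cesaro T N (mid m n)" "M N"] ces[of N "mid m n"] by linarith
    qed
  qed
  define L where "L = (INF n\<in>{0<..}. gns_seminorm \<phi> (M n))"
  have bdd: "bdd_below ((\<lambda>n. gns_seminorm \<phi> (M n)) ` {0<..})"
    by (auto intro: bdd_belowI2[of _ 0] simp: gns_seminorm_nonneg[OF state])
  have L_le: "L \<le> gns_seminorm \<phi> (M n)" if "0 < n" for n
    unfolding L_def using that by (intro cINF_lower bdd) auto
  have L0: "0 \<le> L" unfolding L_def by (intro cINF_greatest) (auto simp: gns_seminorm_nonneg[OF state])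
  have L_mid: "L \<le> gns_seminorm \<phi> (mid m n)" if "0 < m" "0 < n" for m n
  proof (rule ccontr)
    assume "\<not> L \<le> gns_seminorm \<phi> (mid m n)"
    then have "\<forall>\<^sub>F N in sequentially. gns_seminorm \<phi> (M N) < L" using upper[OF that, of L] by simp
    from eventually_happens'[OF sequentially_bot eventually_conj[OF this eventually_gt_at_top[of 0]]]
    obtain N where "gns_seminorm \<phi> (M N) < L" "0 < N" by blast
    then show False using L_le[of N] by simp
  qed
  have "(\<lambda>n. gns_seminorm \<phi> (M n)) \<longlonglongrightarrow> L"
  proof (rule order_tendstoI)
    fix c assume "c < L"
    then have "c < gns_seminorm \<phi> (M n)" if "0 < n" for n using L_le[OF that] by simp
    then show "\<forall>\<^sub>F n in sequentially. c < gns_seminorm \<phi> (M n)"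
      by (rule eventually_mono[OF eventually_gt_at_top])
  next
    fix c assume "L < c"
    then obtain n where n: "0 < n" "gns_seminorm \<phi> (M n) < c"
      unfolding L_def using bdd by (subst (asm) cINF_less_iff) auto
    moreover have "mid n n = M n" by (simp add: mid_def scaleR_2[symmetric])
    ultimately show "\<forall>\<^sub>F N in sequentially. gns_seminorm \<phi> (M N) < c" using upper[of n n c] by simp
  qed
  then have lim2: "(\<lambda>n. (gns_seminorm \<phi> (M n))\<^sup>2) \<longlonglongrightarrow> L\<^sup>2" by (intro tendsto_power)
  show ?thesis
    unfolding gns_Cauchy_def M_def[symmetric]
  proof (intro CollectI allI impI)
    fix e :: real assume e: "0 < e"
    then have "L\<^sup>2 < L\<^sup>2 + e\<^sup>2 / 4" by simp
    from order_tendstoD(2)[OF lim2 this] obtain N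
      where N: "\<And>n. N \<le> n \<Longrightarrow> (gns_seminorm \<phi> (M n))\<^sup>2 < L\<^sup>2 + e\<^sup>2 / 4"
      unfolding eventually_sequentially by blast
    have "gns_seminorm \<phi> (M m - M n) < e" if mn: "max N 1 \<le> m" "max N 1 \<le> n" for m n
    proof -
      have "L\<^sup>2 \<le> (gns_seminorm \<phi> (mid m n))\<^sup>2" using L_mid[of m n] mn L0 by (intro power_mono) auto
      then have "4 * L\<^sup>2 \<le> (gns_seminorm \<phi> (M m + M n))\<^sup>2"
        by (simp add: mid_def s_scale power_mult_distrib power_divide)
      then have "(gns_seminorm \<phi> (M m - M n))\<^sup>2 < e\<^sup>2"
        using gns_seminorm_parallelogram[OF state, of "M m" "M n"] N[of m] N[of n] mn by simp
      then show ?thesis using e by (simp add: power_less_imp_less_base)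
    qed
    then show "\<exists>N. \<forall>m\<ge>N. \<forall>n\<ge>N. gns_seminorm \<phi> (M m - M n) < e" by blast
  qed
qed

section \<open>From invariant states to eigenvalues\<close>

text \<open>
  The eigenvector is the class of the sequence of twisted means. It is an eigenvector because
  $T M_n - M_n$ tends to $0$ for the twisted map $T = z^{-1} \Phi$, and nonzero because the seminorms of the
  means are bounded below by $\varepsilon$.
\<close>

lemma eigenvalue_from_invariant_state:
  fixes \<Phi> :: "'a::cstar_algebra \<Rightarrow> 'a"
  assumes hom: "unital_star_hom \<Phi>" and inv: "\<phi> \<in> invariant_states \<Phi>" and z: "cmod z = 1"
    and \<epsilon>: "0 < \<epsilon>"
    and bound: "\<And>m. 0 < m \<Longrightarrow> \<epsilon>\<^sup>2 \<le> Re (\<phi> (star (cesaro (twist (inverse z) \<Phi>) m a) * cesaro (twist (inverse z) \<Phi>) m a))"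
  shows "gns_eigenvalue \<phi> (gns_isometry \<phi> \<Phi>) z"
proof -
  define T where "T = twist (inverse z) \<Phi>"
  define X where "X n = cesaro T n a" for n
  have z0: "z \<noteq> 0" using z by auto
  have w: "cmod (inverse z) = 1" using z by (simp add: norm_inverse)
  have state: "\<phi> \<in> states" using inv by (simp add: invariant_states_def)
  have lin: "linear T" unfolding T_def by (rule linear_twist[OF hom w])
  have le: "norm (T x) \<le> norm x" for x unfolding T_def by (rule norm_twist_le[OF hom w])
  have X: "X \<in> gns_Cauchy \<phi>" unfolding X_def
    by (rule mean_ergodic_gns_Cauchy[OF state lin le])
      (simp add: T_def twist_def gns_seminorm_scaleC[OF state] w gns_seminorm_hom[OF hom inv] z)
  have "gns_class \<phi> X \<noteq> gns_zero \<phi>"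
  proof
    assume "gns_class \<phi> X = gns_zero \<phi>"
    then have lim: "(\<lambda>n. gns_seminorm \<phi> (X n)) \<longlonglongrightarrow> 0"
      using gns_class_eq_iff[OF state X gns_Cauchy_const[OF state, of 0]] by (simp add: gns_zero_def)
    have "\<epsilon> \<le> gns_seminorm \<phi> (X n)" if "0 < n" for n
      using bound[OF that] by (simp add: gns_seminorm_def X_def T_def real_le_rsqrt)
    then have "\<epsilon> \<le> 0" by (intro LIMSEQ_le_const[OF lim] exI[of _ 1]) auto
    then show False using \<epsilon> by simp
  qed
  moreover have "gns_isometry \<phi> \<Phi> (gns_class \<phi> X) = gns_scale \<phi> z (gns_class \<phi> X)"
  proof -
    have comm: "T (cesaro T n a) = cesaro T n (T a)" for n
      by (simp add: cesaro_def linear_scale[OF lin] linear_sum[OF lin] funpow_swap1)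
    have "(\<lambda>n. gns_seminorm \<phi> (cesaro T n (T a) - cesaro T n a)) \<longlonglongrightarrow> 0"
      by (intro gns_seminorm_tendsto_0[OF state] cesaro_shift_tendsto lin le)
    moreover have "\<Phi> (X n) - z *\<^sub>C X n = z *\<^sub>C (cesaro T n (T a) - cesaro T n a)" for n
      unfolding comm[symmetric] using z0 by (simp add: X_def T_def twist_def scaleC_diff_right scaleC_scaleC scaleC_one)
    ultimately have "(\<lambda>n. gns_seminorm \<phi> (\<Phi> (X n) - z *\<^sub>C X n)) \<longlonglongrightarrow> 0"
      by (simp add: gns_seminorm_scaleC[OF state] z)
    then show ?thesis
      using gns_isometry_class[OF hom inv X] gns_scale_class[OF state X] gns_class_eq_iff[OF state] by metis
  qed
  ultimately show ?thesis
    unfolding gns_eigenvalue_def using gns_class_in_space[OF state X] by blast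
qed

theorem theorem3p4:
  fixes \<Phi> :: "'a::cstar_algebra \<Rightarrow> 'a" and z :: complex
  assumes "unital_star_hom \<Phi>"
    and "z \<in> sphere 0 1 - full_peripheral_pp_spectrum \<Phi>"
  shows "\<forall>a. (\<lambda>n. (1 / real n) *\<^sub>R (\<Sum>k<n. (z powi (- int k)) *\<^sub>C (\<Phi> ^^ k) a)) \<longlonglongrightarrow> 0"
proof
  fix a
  define M where "M n = cesaro (twist (inverse z) \<Phi>) n a" for n
  have z: "cmod z = 1" and notin: "z \<notin> full_peripheral_pp_spectrum \<Phi>" using assms(2) by auto
  have w: "cmod (inverse z) = 1" using z by (simp add: norm_inverse)
  have "M \<longlonglongrightarrow> 0"
  proof (rule ccontr)
    assume "\<not> M \<longlonglongrightarrow> 0"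
    then obtain \<epsilon> where \<epsilon>: "0 < \<epsilon>" "\<exists>\<^sub>F n in sequentially. \<epsilon> \<le> norm (M n)"
      unfolding tendsto_iff by (auto simp: not_eventually not_less)
    obtain \<phi> where \<phi>: "\<phi> \<in> invariant_states \<Phi>"
      "\<And>m. 0 < m \<Longrightarrow> \<epsilon>\<^sup>2 \<le> Re (\<phi> (star (M m) * M m))"
      using invariant_state_exists[OF assms(1) w \<epsilon>(1), of a] \<epsilon>(2) unfolding M_def by blast
    have "gns_eigenvalue \<phi> (gns_isometry \<phi> \<Phi>) z"
      by (rule eigenvalue_from_invariant_state[OF assms(1) \<phi>(1) z \<epsilon>(1) \<phi>(2)[unfolded M_def]])
    then have "z \<in> full_peripheral_pp_spectrum \<Phi>"
      unfolding full_peripheral_pp_spectrum_def peripheral_pp_spectrum_def using \<phi>(1) z by auto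
    then show False using notin by contradiction
  qed
  then show "(\<lambda>n. (1 / real n) *\<^sub>R (\<Sum>k<n. (z powi (- int k)) *\<^sub>C (\<Phi> ^^ k) a)) \<longlonglongrightarrow> 0"
    by (simp add: M_def[abs_def] cesaro_def twist_funpow[OF assms(1) w] power_int_minus power_inverse)
qed

end
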